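(* For every integer $n\ge1$, every $c_g>1$ and every $\xi\ge0$ there is a constant $C_2=C_2(c_g,n,\xi)$ with the following property. Let $g$ be a $c_g$-bounded Riemannian metric on the sphere $\mathbb{S}^n$, let $a,d>0$, $b>1+\xi\ge1$ and $\epsilon>0$. Then (1) the metric $\mathcal{T}_{a,d}\,g$ is hyperbolic on $B_a$; (2) the metric $\mathcal{T}_{a,d}\,g$ is radially $\epsilon$-close to hyperbolic outside $B_b$ (that is, on $\mathbb{R}^{n+1}\setminus B_b$), with charts of excess $\xi$, provided $$C_2\left(e^{-b}+\frac1d\right)\le\epsilon .$$
   Context: $B_r\subset\mathbb{R}^{n+1}$ is the ball of radius $r$ centered at the origin; $\mathbb{R}^{n+1}\setminus\{0\}$ is identified with $\mathbb{S}^n\times(0,\infty)$ by polar coordinates; $\sigma_{\mathbb{S}^n}$ is the canonical round metric. Two variable warping deformation: fix a smooth function $\rho:\mathbb{R}\to[0,1]$ with $\rho(t)=0$ for $t\le0$, $\rho(t)=1$ for $t\ge1$, $|\rho'|<3$ and $|\rho''|<12$. For $a,d>0$ put $\rho_{a,d}(t)=\rho\big(2\frac{t-a}{d}\big)$, $(g_{a,d})_t=\sigma_{\mathbb{S}^n}+\rho_{a,d}(t)(g-\sigma_{\mathbb{S}^n})$ and $$\mathcal{T}_{a,d}\,g=\sinh^2(t)\,(g_{a,d})_t+dt^2,$$ a Riemannian metric on $\mathbb{R}^{n+1}$. $c$-bounded ($c>1$): for each $n$ fix a finite atlas of $\mathbb{S}^n$ whose charts $\psi:U\to\mathbb{S}^n$,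 $U\subset\mathbb{R}^n$, extend to the compact closure of their domains and such that for every $p\in\mathbb{S}^n$ some chart satisfies $d_{\mathbb{R}^n}(\psi^{-1}(p),\mathbb{R}^n\setminus U)\ge1$. A metric $g$ on $\mathbb{S}^n$ is $c$-bounded if in every chart of this atlas its matrix satisfies $|g|_{C^2}<c$ and $|\det g|>1/c$ at every point. Here $|\cdot|_{C^2}$ is the uniform $C^2$ norm: the maximum of the sup norms of all partial derivatives of order $\le 2$ of the entries. Radially $\epsilon$-close to hyperbolic with charts of excess $\xi$: let $\mathbb{B}\subset\mathbb{R}^n$ be the unit ball and $\mathbb{T}_\xi=\mathbb{B}\times(-(1+\xi),1+\xi)$ with metric $\sigma=e^{2t}\sigma_{\mathbb{R}^n}+dt^2$, $\sigma_{\mathbb{R}^n}$ flat. A metric $h$ on $\mathbb{S}^n\times(0,\infty)$ of the form $\tilde g_t+dt^2$ is radially $\epsilon$-close to hyperbolic on a subset $S$, with charts of excess $\xi$, if for every $p\in S$ there is a chart (diffeomorphism onto an open subset) $\phi:\mathbb{T}_\xi\to\mathbb{S}^n\times(0,\infty)$ with $\phi(0,0)=p$, of the form $\phi(x,t)=(\phi_1(x),t+t_0)$ for some number $t_0$ and chart $\phi_1$ of $\mathbb{S}^n$, such that $|\phi^*h-\sigma|_{C^2}<\epsilon$. *)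

theory Defs
  imports "HOL-Analysis.Analysis"
begin

section \<open>Smooth maps and uniform second order norms\<close>

text \<open>
  Iterated directional derivatives; along lists of basis vectors these are the iterated partial
  derivatives. On an open set, \<open>f\<close> is smooth iff all its iterated partial derivatives exist and are
  differentiable.
\<close>

primrec iter_deriv ::
  "'a list \<Rightarrow> ('a::real_normed_vector \<Rightarrow> 'b::real_normed_vector) \<Rightarrow> 'a \<Rightarrow> 'b" where
  "iter_deriv [] f = f"
| "iter_deriv (v # vs) f = (\<lambda>x. frechet_derivative (iter_deriv vs f) (at x) v)"

definition smooth_on ::
  "'a set \<Rightarrow> ('a::euclidean_space \<Rightarrow> 'b::real_normed_vector) \<Rightarrow> bool" where
  "smooth_on U f \<longleftrightarrow>
     (\<forall>vs. set vs \<subseteq> Basis \<longrightarrow> (\<forall>x\<in>U. iter_deriv vs f differentiable (at x)))"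

text \<open>
  A field of bilinear forms: \<open>h x v w\<close> is the value at the point \<open>x\<close> on the vectors \<open>v\<close>, \<open>w\<close>. On a
  submanifold of the ambient space only points of it and vectors tangent to it are relevant.
\<close>

type_synonym 'a tensor2 = "'a \<Rightarrow> 'a \<Rightarrow> 'a \<Rightarrow> real"

definition pullback ::
  "('a::real_normed_vector \<Rightarrow> 'b::real_normed_vector) \<Rightarrow> 'b tensor2 \<Rightarrow> 'a tensor2" where
  "pullback F h x v w =
     h (F x) (frechet_derivative F (at x) v) (frechet_derivative F (at x) w)"

text \<open>
  The norm is extended-real valued, so that it is infinite when some derivative is unbounded.
\<close>

definition C2_norm :: "'a set \<Rightarrow> 'a::euclidean_space tensor2 \<Rightarrow> ereal" where
  "C2_norm U h =
     (SUP (i, j, vs, x) \<in> Basis \<times> Basis \<times> {vs. set vs \<subseteq> Basis \<and> length vs \<le> 2} \<times> U.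
        ereal \<bar>iter_deriv vs (\<lambda>y. h y i j) x\<bar>)"


section \<open>The sphere\<close>

text \<open>
  A chart is a smooth parametrization of an open piece of the unit sphere: a diffeomorphism from an
  open set of a Euclidean space onto an open subset of the sphere.
\<close>

definition sphere_chart ::
  "'a::euclidean_space set \<Rightarrow> ('a \<Rightarrow> 'b::euclidean_space) \<Rightarrow> bool" where
  "sphere_chart U \<psi> \<longleftrightarrow>
     open U \<and> smooth_on U \<psi> \<and>
     openin (top_of_set (sphere 0 1)) (\<psi> ` U) \<and>
     (\<exists>\<theta>. homeomorphism U (\<psi> ` U) \<psi> \<theta>) \<and>
     (\<forall>x\<in>U. inj (frechet_derivative \<psi> (at x)))"

text \<open>
  The tangent space of the unit sphere at \<open>p\<close> is the orthogonal complement of \<open>p\<close>.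
\<close>

definition sphere_tangent :: "'b::euclidean_space \<Rightarrow> 'b set" where
  "sphere_tangent p = {v. v \<bullet> p = 0}"

definition riemannian_sphere ::
  "'a::euclidean_space itself \<Rightarrow> 'b::euclidean_space tensor2 \<Rightarrow> bool" where
  "riemannian_sphere _ g \<longleftrightarrow>
     (\<forall>p\<in>sphere 0 1.
        (\<forall>u\<in>sphere_tangent p. \<forall>v\<in>sphere_tangent p. \<forall>w\<in>sphere_tangent p. \<forall>\<alpha> \<beta>.
           g p (\<alpha> *\<^sub>R u + \<beta> *\<^sub>R v) w = \<alpha> * g p u w + \<beta> * g p v w) \<and>
        (\<forall>v\<in>sphere_tangent p. \<forall>w\<in>sphere_tangent p. g p v w = g p w v) \<and>
        (\<forall>v\<in>sphere_tangent p. v \<noteq> 0 \<longrightarrow> g p v v > 0)) \<and>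
     (\<forall>(U :: 'a set) \<psi>. sphere_chart U \<psi> \<longrightarrow>
        (\<forall>i\<in>Basis. \<forall>j\<in>Basis. smooth_on U (\<lambda>x. pullback \<psi> g x i j)))"

definition round_metric :: "'b::euclidean_space tensor2" where
  "round_metric p v w = v \<bullet> w"

text \<open>
  The finite atlases with respect to which boundedness of metrics is measured. Extending to the
  compact closure of the domain means: being the restriction of a chart whose domain contains that
  closure. The last condition also makes the charts cover the sphere.
\<close>

definition admissible_atlas ::
  "(('a::euclidean_space) set \<times> ('a \<Rightarrow> 'b::euclidean_space)) set \<Rightarrow> bool" where
  "admissible_atlas \<A> \<longleftrightarrow>
     finite \<A> \<and>
     (\<forall>(U, \<psi>) \<in> \<A>. sphere_chart U \<psi> \<and> compact (closure U) \<and>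
        (\<exists>V \<psi>'. closure U \<subseteq> V \<and> sphere_chart V \<psi>' \<and> (\<forall>x\<in>U. \<psi>' x = \<psi> x))) \<and>
     (\<forall>p\<in>sphere 0 1. \<exists>(U, \<psi>) \<in> \<A>. \<exists>x\<in>U. \<psi> x = p \<and> infdist x (- U) \<ge> 1)"

definition chart_matrix ::
  "(real ^ 'n \<Rightarrow> 'b::euclidean_space) \<Rightarrow> 'b tensor2 \<Rightarrow> real ^ 'n \<Rightarrow> real ^ 'n ^ 'n" where
  "chart_matrix \<psi> g x = (\<chi> i j. pullback \<psi> g x (axis i 1) (axis j 1))"

definition c_bounded ::
  "((real ^ 'n) set \<times> (real ^ 'n \<Rightarrow> 'b::euclidean_space)) set \<Rightarrow> real \<Rightarrow> 'b tensor2 \<Rightarrow> bool" where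
  "c_bounded \<A> c g \<longleftrightarrow>
     (\<forall>(U, \<psi>) \<in> \<A>. C2_norm U (pullback \<psi> g) < ereal c \<and>
        (\<forall>x\<in>U. \<bar>det (chart_matrix \<psi> g x)\<bar> > 1 / c))"


section \<open>Two variable warping deformation\<close>

definition warping_cutoff :: "(real \<Rightarrow> real) \<Rightarrow> bool" where
  "warping_cutoff \<rho> \<longleftrightarrow>
     smooth_on UNIV \<rho> \<and> (\<forall>t. 0 \<le> \<rho> t \<and> \<rho> t \<le> 1) \<and>
     (\<forall>t\<le>0. \<rho> t = 0) \<and> (\<forall>t\<ge>1. \<rho> t = 1) \<and>
     (\<forall>t. \<bar>deriv \<rho> t\<bar> < 3) \<and> (\<forall>t. \<bar>deriv (deriv \<rho>) t\<bar> < 12)"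

definition radial_metric :: "(real \<Rightarrow> 'b tensor2) \<Rightarrow> ('b \<times> real) tensor2" where
  "radial_metric G = (\<lambda>(y, t) (v, r) (w, s). G t y v w + r * s)"

definition deformed_family ::
  "(real \<Rightarrow> real) \<Rightarrow> real \<Rightarrow> real \<Rightarrow> 'b::euclidean_space tensor2 \<Rightarrow> real \<Rightarrow> 'b tensor2" where
  "deformed_family \<rho> a d g t y v w =
     round_metric y v w + \<rho> (2 * ((t - a) / d)) * (g y v w - round_metric y v w)"

definition warped ::
  "(real \<Rightarrow> real) \<Rightarrow> real \<Rightarrow> real \<Rightarrow> 'b::euclidean_space tensor2 \<Rightarrow> ('b \<times> real) tensor2" where
  "warped \<rho> a d g =
     radial_metric (\<lambda>t y v w. (sinh t)\<^sup>2 * deformed_family \<rho> a d g t y v w)"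

definition polar :: "'b::euclidean_space \<Rightarrow> 'b \<times> real" where
  "polar x = (x /\<^sub>R norm x, norm x)"

text \<open>
  The deformed metric on the whole space. Polar coordinates are undefined at the origin; near it the
  metric is \<open>sinh\<^sup>2 t \<sigma> + dt\<^sup>2\<close>, whose continuous (and smooth) extension to the origin is the
  Euclidean inner product there.
\<close>

definition warped_space ::
  "(real \<Rightarrow> real) \<Rightarrow> real \<Rightarrow> real \<Rightarrow> 'b::euclidean_space tensor2 \<Rightarrow> 'b tensor2" where
  "warped_space \<rho> a d g x v w =
     (if x = 0 then v \<bullet> w else pullback polar (warped \<rho> a d g) x v w)"


section \<open>Hyperbolic and radially close to hyperbolic metrics\<close>

text \<open>
  Hyperbolic space in the Poincare ball model.
\<close>

definition poincare_metric :: "'b::euclidean_space tensor2" where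
  "poincare_metric x v w = 4 * (v \<bullet> w) / (1 - (norm x)\<^sup>2)\<^sup>2"

definition diffeo_onto_open ::
  "'a::euclidean_space set \<Rightarrow> ('a \<Rightarrow> 'b::euclidean_space) \<Rightarrow> bool" where
  "diffeo_onto_open N F \<longleftrightarrow>
     open N \<and> smooth_on N F \<and> inj_on F N \<and> open (F ` N) \<and> smooth_on (F ` N) (the_inv_into N F)"

text \<open>
  A metric is hyperbolic if it is locally isometric to hyperbolic space of the same dimension.
\<close>

definition hyperbolic_on :: "'b::euclidean_space set \<Rightarrow> 'b tensor2 \<Rightarrow> bool" where
  "hyperbolic_on W h \<longleftrightarrow>
     (\<forall>x\<in>W. \<exists>N (F :: 'b \<Rightarrow> 'b). x \<in> N \<and> N \<subseteq> W \<and> diffeo_onto_open N F \<and> F ` N \<subseteq> ball 0 1 \<and>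
        (\<forall>y\<in>N. \<forall>v w. h y v w = pullback F poincare_metric y v w))"

definition model_domain :: "real \<Rightarrow> ('a::euclidean_space \<times> real) set" where
  "model_domain \<xi> = ball 0 1 \<times> {- (1 + \<xi>)<..<1 + \<xi>}"

definition model_metric :: "('a::euclidean_space \<times> real) tensor2" where
  "model_metric = radial_metric (\<lambda>t x v w. exp (2 * t) * (v \<bullet> w))"

text \<open>
  The first argument fixes the Euclidean space on which the charts of the sphere are modelled. The
  metric \<open>h\<close> and the set \<open>S\<close> live on the product of the unit sphere with the positive reals. Since
  the sphere component \<open>\<phi>\<^sub>1\<close> is a chart and the other component a translation, \<open>\<phi>\<close> is automatically a
  diffeomorphism onto an open subset of the product once its second component is positive.
\<close>

definition radially_close ::
  "'a::euclidean_space itself \<Rightarrow> real \<Rightarrow> real \<Rightarrow> ('b::euclidean_space \<times> real) tensor2 \<Rightarrow>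
     ('b \<times> real) set \<Rightarrow> bool" where
  "radially_close _ \<epsilon> \<xi> h S \<longleftrightarrow>
     (\<exists>G. h = radial_metric G) \<and>
     (\<forall>p\<in>S. \<exists>\<phi> (\<phi>\<^sub>1 :: 'a \<Rightarrow> 'b) t\<^sub>0.
        \<phi> = (\<lambda>(x, t). (\<phi>\<^sub>1 x, t + t\<^sub>0)) \<and>
        sphere_chart (ball 0 1) \<phi>\<^sub>1 \<and>
        \<phi> ` model_domain \<xi> \<subseteq> sphere 0 1 \<times> {0<..} \<and>
        \<phi> (0, 0) = p \<and>
        C2_norm (model_domain \<xi>) (\<lambda>z v w. pullback \<phi> h z v w - model_metric z v w) < ereal \<epsilon>)"

end

(*
  Near the origin the metric is sinh^2 t sigma + dt^2, and x |-> tanh(|x|/2) x/|x| is an isometry onto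
  a ball of the Poincare model. It and its inverse are smooth because tanh(r/2)/r and artanh(r)/r are
  built from power series in r^2.

  Away from the origin, at a point (p, s), take a chart of the atlas around p, an orthonormal frame B
  for the metric g_s at p, and the chart x |-> psi(c + 2 e^(-s) B x). Since
  4 e^(-2s) sinh^2(t + s) = e^(2t) + O(e^(-s)), the pulled back metric is e^(2t) times the coefficient
  matrix of g_(s+t) in the frame, up to O(e^(-b)). That matrix is the identity at the centre and varies
  by O(e^(-s)) in x (because of the scaling) and O(1/d) in t (because of the cutoff). All constants are
  uniform: upper bounds come from c-boundedness, lower bounds on the metric from compactness of the set
  of positive semidefinite matrices with bounded entries and determinant bounded below.

  This works only for d bounded below, as second derivatives of the cutoff cost 1/d^2. If epsilon
  exceeds the C^2 norm of e^(2t) by more than a fixed margin, one shrinks the chart instead, which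
  makes the pulled back metric negligible; if not, the hypothesis forces e^(-b) and 1/d to be small.
*)

theory Submission
  imports Defs
begin

section \<open>Calculus of smooth maps\<close>


text \<open>Two metrics must be controlled, and for different reasons. For \<open>g\<close> the
  upper bounds are hypotheses; for the round metric both bounds come from compactness of the
  closures of the chart domains, which is why the charts have to extend. The deformed metric at any
  time is a convex combination of the two, so it inherits a common lower bound l whatever
  \<open>a\<close>, \<open>d\<close> and the time are. Hence an orthonormal frame has norm at most
  1/sqrt(l), a bound that does not see the point or the time. The scaled chart must also stay inside
  the unit ball around the centre that the atlas provides. This asks for n 2 e^(-s)/sqrt(l) <= 1,
  which b > 1 + xi does not ensure, so a small \<open>b\<close> is a second reason for the case
  distinction on epsilon. The margin in that distinction leaves room for the error of the shrunken
  metric, and every estimate ends with a real bound strictly below epsilon because the norm is a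
  supremum. The oscillation of the coefficients is measured by the mean value inequality on the
  model domain, which is convex and bounded; this makes the constants depend on xi.\<close>

lemma frechet_derivative_cong_open:
  assumes "open U" "x \<in> U" "\<And>y. y \<in> U \<Longrightarrow> f y = g y"
  shows "frechet_derivative f (at x) = frechet_derivative g (at x)"
proof -
  \<comment> \<open>\<open>frechet_derivative\<close> is a choice among all derivatives at
    \<open>x\<close>. The two functions have the same derivatives there, so the choices agree even
    if there are none.\<close>
  have "(f has_derivative D) (at x) \<longleftrightarrow> (g has_derivative D) (at x)" for D
    using has_derivative_transform_within_open[OF _ assms(1,2), of f D UNIV g]
      has_derivative_transform_within_open[OF _ assms(1,2), of g D UNIV f] assms(3) by auto
  then show ?thesis
    by (simp add: frechet_derivative_def)
qed

lemma differentiable_cong_open: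
  assumes "open U" "x \<in> U" "\<And>y. y \<in> U \<Longrightarrow> f y = g y" "f differentiable (at x)"
  shows "g differentiable (at x)"
  using assms has_derivative_transform_within_open[OF _ assms(1,2), of f _ UNIV g]
  unfolding differentiable_def by blast

lemma iter_deriv_append: "iter_deriv (vs @ ws) f = iter_deriv vs (iter_deriv ws f)"
  by (induction vs) auto

text \<open>The recursion differentiates \<open>f\<close> before passing to lower order, whereas
  \<open>iter_deriv\<close> adds derivatives on the outside, the last list entry being the innermost
  one. This direction suits inductions: the derivative of a sum, product or composition is built
  from the same kind of terms.\<close>

primrec k_smooth_on ::
  "nat \<Rightarrow> 'a::euclidean_space set \<Rightarrow> ('a \<Rightarrow> 'b::real_normed_vector) \<Rightarrow> bool" where
  "k_smooth_on 0 U f \<longleftrightarrow> (\<forall>x\<in>U. f differentiable (at x))"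
| "k_smooth_on (Suc n) U f \<longleftrightarrow> (\<forall>x\<in>U. f differentiable (at x)) \<and>
     (\<forall>v\<in>Basis. k_smooth_on n U (\<lambda>x. frechet_derivative f (at x) v))"

lemma k_smooth_on_iff:
  "k_smooth_on n U f \<longleftrightarrow>
     (\<forall>vs. set vs \<subseteq> Basis \<and> length vs \<le> n \<longrightarrow> (\<forall>x\<in>U. iter_deriv vs f differentiable (at x)))"
proof (induction n arbitrary: f)
  case (Suc n)
  show ?case (is "_ \<longleftrightarrow> ?R")
  proof
    assume L: "k_smooth_on (Suc n) U f"
    show ?R
    proof safe
      fix vs :: "'a list" and x assume vs: "set vs \<subseteq> Basis" "length vs \<le> Suc n" "x \<in> U"
      show "iter_deriv vs f differentiable (at x)"
      proof (cases vs rule: rev_cases)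
        case (snoc ws v)
        then show ?thesis using L vs Suc by (simp add: iter_deriv_append)
      qed (use L vs in simp)
    qed
  next
    assume R: ?R
    have "k_smooth_on n U (\<lambda>x. frechet_derivative f (at x) v)" if "v \<in> Basis" for v
      unfolding Suc
    proof safe
      fix vs :: "'a list" and x assume "set vs \<subseteq> Basis" "length vs \<le> n" "x \<in> U"
      then show "iter_deriv vs (\<lambda>x. frechet_derivative f (at x) v) differentiable (at x)"
        using R[rule_format, of "vs @ [v]" x] that by (simp add: iter_deriv_append)
    qed
    then show "k_smooth_on (Suc n) U f"
      using R[rule_format, of "[]"] by simp
  qed
qed auto

lemma smooth_on_iff: "smooth_on U f \<longleftrightarrow> (\<forall>n. k_smooth_on n U f)"
  unfolding k_smooth_on_iff smooth_on_def by auto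

lemma k_smooth_on_differentiable: "k_smooth_on n U f \<Longrightarrow> x \<in> U \<Longrightarrow> f differentiable (at x)"
  by (cases n) auto

lemma k_smooth_on_has_derivative:
  "k_smooth_on n U f \<Longrightarrow> x \<in> U \<Longrightarrow> (f has_derivative frechet_derivative f (at x)) (at x)"
  using k_smooth_on_differentiable frechet_derivative_works by blast

lemma k_smooth_on_cong:
  assumes "open U" "\<And>x. x \<in> U \<Longrightarrow> f x = g x" "k_smooth_on n U f"
  shows "k_smooth_on n U g"
  using assms(2,3)
proof (induction n arbitrary: f g)
  case 0
  then show ?case using differentiable_cong_open[OF assms(1)] by (metis k_smooth_on.simps(1))
next
  case (Suc n)
  have "k_smooth_on n U (\<lambda>x. frechet_derivative g (at x) v)" if "v \<in> Basis" for v
    by (rule Suc.IH[where f = "\<lambda>x. frechet_derivative f (at x) v"])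
      (use frechet_derivative_cong_open[OF assms(1), of _ f g] Suc.prems that in auto)
  then show ?case
    using differentiable_cong_open[OF assms(1), of _ f g] Suc.prems by auto
qed

text \<open>Lets an explicit formula stand in for the derivative chosen by
  \<open>frechet_derivative\<close>.\<close>

lemma k_smooth_on_SucI:
  assumes "open U" "\<And>x. x \<in> U \<Longrightarrow> (f has_derivative f' x) (at x)"
    and "\<And>v. v \<in> Basis \<Longrightarrow> k_smooth_on n U (\<lambda>x. f' x v)"
  shows "k_smooth_on (Suc n) U f"
proof -
  have "k_smooth_on n U (\<lambda>x. frechet_derivative f (at x) v)" if "v \<in> Basis" for v
    by (rule k_smooth_on_cong[OF assms(1) _ assms(3)[OF that]])
      (use frechet_derivative_at[OF assms(2)] in metis)
  then show ?thesis
    using assms(2) unfolding k_smooth_on.simps differentiable_def by blast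
qed

lemma k_smooth_on_Suc: "k_smooth_on (Suc n) U f \<Longrightarrow> k_smooth_on n U f"
  by (simp add: k_smooth_on_iff del: k_smooth_on.simps)

lemma k_smooth_on_const: "open U \<Longrightarrow> k_smooth_on n U (\<lambda>x. c)"
proof (induction n arbitrary: c)
  case (Suc n)
  show ?case
    by (rule k_smooth_on_SucI[where f' = "\<lambda>x v. 0"]) (use Suc in auto)
qed simp

lemma k_smooth_on_bounded_linear:
  assumes "bounded_linear f" "open U"
  shows "k_smooth_on n U f"
proof (cases n)
  case 0
  then show ?thesis
    using assms bounded_linear_imp_differentiable by auto
next
  case (Suc m)
  show ?thesis unfolding Suc
    by (rule k_smooth_on_SucI[where f' = "\<lambda>x. f"])
      (use assms k_smooth_on_const bounded_linear_imp_has_derivative in auto)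
qed

lemma k_smooth_on_add:
  assumes "open U" "k_smooth_on n U f" "k_smooth_on n U g"
  shows "k_smooth_on n U (\<lambda>x. f x + g x)"
  using assms(2,3)
proof (induction n arbitrary: f g)
  case (Suc n)
  show ?case
    by (rule k_smooth_on_SucI[where
        f' = "\<lambda>x v. frechet_derivative f (at x) v + frechet_derivative g (at x) v"])
      (use Suc assms(1) in \<open>auto intro!: has_derivative_add simp flip: frechet_derivative_works\<close>)
qed auto

lemma k_smooth_on_bilinear:
  fixes f :: "'d::euclidean_space \<Rightarrow> 'a::real_normed_vector" and g :: "'d \<Rightarrow> 'b::real_normed_vector"
  assumes "bounded_bilinear prd" "open U" "k_smooth_on n U f" "k_smooth_on n U g"
  shows "k_smooth_on n U (\<lambda>x. prd (f x) (g x))"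
  using assms(3,4)
proof (induction n arbitrary: f g)
  case 0
  have "(\<lambda>x. prd (f x) (g x)) differentiable (at x)" if "x \<in> U" for x
    using bounded_bilinear.FDERIV[OF assms(1) k_smooth_on_has_derivative[OF 0(1) that]
        k_smooth_on_has_derivative[OF 0(2) that]]
    unfolding differentiable_def by blast
  then show ?case by simp
next
  case (Suc n)
  show ?case
  proof (rule k_smooth_on_SucI[OF assms(2), where
        f' = "\<lambda>x v. prd (f x) (frechet_derivative g (at x) v) + prd (frechet_derivative f (at x) v) (g x)"])
    fix x assume "x \<in> U"
    then show "((\<lambda>x. prd (f x) (g x)) has_derivative
      (\<lambda>v. prd (f x) (frechet_derivative g (at x) v) + prd (frechet_derivative f (at x) v) (g x))) (at x)"
      by (intro bounded_bilinear.FDERIV[OF assms(1)] k_smooth_on_has_derivative[OF Suc.prems(1)]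
          k_smooth_on_has_derivative[OF Suc.prems(2)])
  next
    fix v :: 'd assume "v \<in> Basis"
    then show "k_smooth_on n U (\<lambda>x. prd (f x) (frechet_derivative g (at x) v)
      + prd (frechet_derivative f (at x) v) (g x))"
      using Suc.prems by (intro k_smooth_on_add assms(2) Suc.IH)
        (simp_all add: k_smooth_on_Suc del: k_smooth_on.simps, simp_all)
  qed
qed

lemmas k_smooth_on_scaleR = k_smooth_on_bilinear[OF bounded_bilinear_scaleR]
lemmas k_smooth_on_mult = k_smooth_on_bilinear[OF bounded_bilinear_mult]
lemmas k_smooth_on_inner = k_smooth_on_bilinear[OF bounded_bilinear_inner]

lemma k_smooth_on_sum:
  assumes "open U" "finite I" "\<And>i. i \<in> I \<Longrightarrow> k_smooth_on n U (f i)"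
  shows "k_smooth_on n U (\<lambda>x. \<Sum>i\<in>I. f i x)"
  using assms(2,3) by (induction I rule: finite_induct)
    (auto intro!: k_smooth_on_add k_smooth_on_const assms(1))

text \<open>The derivative - f'/f^2 contains the reciprocal of \<open>f\<close> only as a factor, so
  the induction hypothesis at lower order covers it.\<close>

lemma k_smooth_on_inverse:
  fixes f :: "'a::euclidean_space \<Rightarrow> real"
  assumes "open U" "\<And>x. x \<in> U \<Longrightarrow> f x \<noteq> 0" "k_smooth_on n U f"
  shows "k_smooth_on n U (\<lambda>x. inverse (f x))"
  using assms(3)
proof (induction n)
  case 0
  then show ?case using assms(2) by (auto intro!: differentiable_inverse)
next
  case (Suc n)
  show ?case
  proof (rule k_smooth_on_SucI[OF assms(1), where
        f' = "\<lambda>x v. (- 1) * (inverse (f x) * (frechet_derivative f (at x) v * inverse (f x)))"])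
    fix x assume "x \<in> U"
    then show "((\<lambda>x. inverse (f x)) has_derivative
       (\<lambda>v. (- 1) * (inverse (f x) * (frechet_derivative f (at x) v * inverse (f x))))) (at x)"
      using Deriv.has_derivative_inverse[OF assms(2) k_smooth_on_has_derivative[OF Suc.prems]]
      by (simp add: mult.assoc)
  next
    fix v :: 'a assume "v \<in> Basis"
    then show "k_smooth_on n U
       (\<lambda>x. (- 1) * (inverse (f x) * (frechet_derivative f (at x) v * inverse (f x))))"
      using Suc.prems Suc.IH k_smooth_on_Suc[OF Suc.prems]
      by (intro k_smooth_on_mult assms(1) k_smooth_on_const) auto
  qed
qed

lemma linear_eq_sum_Basis:
  fixes f :: "'a::euclidean_space \<Rightarrow> 'b::real_vector"
  assumes "linear f"
  shows "f v = (\<Sum>e\<in>Basis. (v \<bullet> e) *\<^sub>R f e)"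
proof -
  have "f v = f (\<Sum>e\<in>Basis. (v \<bullet> e) *\<^sub>R e)" by (simp add: euclidean_representation)
  then show ?thesis using assms by (simp add: linear_sum linear_cmul)
qed

text \<open>The chain rule is expanded over basis vectors: the induction hypothesis, general in
  \<open>h\<close>, speaks about \<open>h\<close> differentiated along a basis vector and composed
  with \<open>f\<close>, and the coefficients are components of partial derivatives of
  \<open>f\<close>.\<close>

lemma k_smooth_on_compose:
  fixes f :: "'a::euclidean_space \<Rightarrow> 'b::euclidean_space" and h :: "'b \<Rightarrow> 'c::real_normed_vector"
  assumes "open U" "f ` U \<subseteq> V" "k_smooth_on n U f" "k_smooth_on n V h"
  shows "k_smooth_on n U (\<lambda>x. h (f x))"
  using assms(3,4)
proof (induction n arbitrary: h)
  case 0
  then show ?case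
    using assms(2) differentiable_chain_at[of f _ h] by (auto simp: o_def)
next
  case (Suc n)
  show ?case
  proof (rule k_smooth_on_SucI[OF assms(1), where
        f' = "\<lambda>x v. \<Sum>e\<in>Basis. (frechet_derivative f (at x) v \<bullet> e) *\<^sub>R frechet_derivative h (at (f x)) e"])
    fix x assume x: "x \<in> U"
    have f: "(f has_derivative frechet_derivative f (at x)) (at x)"
      by (rule k_smooth_on_has_derivative[OF Suc.prems(1) x])
    have "f x \<in> V" using x assms(2) by blast
    note h = k_smooth_on_has_derivative[OF Suc.prems(2) this]
    show "((\<lambda>x. h (f x)) has_derivative (\<lambda>v. \<Sum>e\<in>Basis.
        (frechet_derivative f (at x) v \<bullet> e) *\<^sub>R frechet_derivative h (at (f x)) e)) (at x)"
      by (rule has_derivative_eq_rhs[OF has_derivative_compose[OF f h]])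
        (rule ext, rule linear_eq_sum_Basis[OF has_derivative_linear[OF h]])
  next
    fix v :: 'a assume "v \<in> Basis"
    then show "k_smooth_on n U (\<lambda>x. \<Sum>e\<in>Basis.
        (frechet_derivative f (at x) v \<bullet> e) *\<^sub>R frechet_derivative h (at (f x)) e)"
      using Suc.prems k_smooth_on_Suc[OF Suc.prems(1)]
      by (intro k_smooth_on_sum k_smooth_on_scaleR k_smooth_on_inner k_smooth_on_const
          Suc.IH assms(1)) auto
  qed
qed

lemma smooth_on_subset: "smooth_on U f \<Longrightarrow> V \<subseteq> U \<Longrightarrow> smooth_on V f"
  unfolding smooth_on_def by blast

lemma smooth_on_cong:
  "open U \<Longrightarrow> (\<And>x. x \<in> U \<Longrightarrow> f x = g x) \<Longrightarrow> smooth_on U f \<Longrightarrow> smooth_on U g"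
  unfolding smooth_on_iff using k_smooth_on_cong by blast

lemma smooth_on_compose:
  fixes f :: "'a::euclidean_space \<Rightarrow> 'b::euclidean_space" and h :: "'b \<Rightarrow> 'c::real_normed_vector"
  assumes "open U" "f ` U \<subseteq> V" "smooth_on U f" "smooth_on V h"
  shows "smooth_on U (\<lambda>x. h (f x))"
  using assms k_smooth_on_compose unfolding smooth_on_iff by blast

lemma smooth_on_bilinear:
  "bounded_bilinear prd \<Longrightarrow> open U \<Longrightarrow> smooth_on U f \<Longrightarrow> smooth_on U g \<Longrightarrow>
    smooth_on U (\<lambda>x. prd (f x) (g x))"
  using k_smooth_on_bilinear unfolding smooth_on_iff by blast

lemma smooth_on_affine:
  assumes "linear l" "open U"
  shows "smooth_on U (\<lambda>x. c + l x)"
  using assms unfolding smooth_on_iff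
  by (intro allI k_smooth_on_add k_smooth_on_const k_smooth_on_bounded_linear)
    (simp_all add: linear_conv_bounded_linear)

lemma smooth_on_partial:
  assumes "smooth_on U f" "v \<in> Basis"
  shows "smooth_on U (\<lambda>x. frechet_derivative f (at x) v)"
  unfolding smooth_on_iff
proof
  fix n
  have "k_smooth_on (Suc n) U f" using assms(1) unfolding smooth_on_iff by blast
  then show "k_smooth_on n U (\<lambda>x. frechet_derivative f (at x) v)" using assms(2) by simp
qed

lemma smooth_on_iter_deriv:
  assumes "smooth_on U f" "set vs \<subseteq> Basis"
  shows "smooth_on U (iter_deriv vs f)"
  using assms(2) by (induction vs) (use assms(1) smooth_on_partial in auto)

lemma smooth_on_has_derivative:
  "smooth_on U f \<Longrightarrow> x \<in> U \<Longrightarrow> (f has_derivative frechet_derivative f (at x)) (at x)"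
  unfolding smooth_on_iff using k_smooth_on_has_derivative by blast

lemma smooth_on_continuous:
  "smooth_on U f \<Longrightarrow> continuous_on U f"
  by (meson continuous_at_imp_continuous_on has_derivative_continuous smooth_on_has_derivative)

section \<open>Bounds on partial derivatives\<close>


text \<open>Bounds on all partial derivatives up to order \<open>n\<close>, in the recursive form of
  \<open>k_smooth_on\<close>. Differentiability below the top order is part of the notion, since
  \<open>frechet_derivative\<close> obeys no calculus rules where no derivative exists.\<close>

primrec k_bounded_on :: "nat \<Rightarrow> real \<Rightarrow> 'a::euclidean_space set \<Rightarrow> ('a \<Rightarrow> real) \<Rightarrow> bool" where
  "k_bounded_on 0 K U f \<longleftrightarrow> (\<forall>x\<in>U. \<bar>f x\<bar> \<le> K)"
| "k_bounded_on (Suc n) K U f \<longleftrightarrow> (\<forall>x\<in>U. \<bar>f x\<bar> \<le> K \<and> f differentiable (at x)) \<and>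
     (\<forall>v\<in>Basis. k_bounded_on n K U (\<lambda>x. frechet_derivative f (at x) v))"

lemma k_bounded_on_bound: "k_bounded_on n K U f \<Longrightarrow> x \<in> U \<Longrightarrow> \<bar>f x\<bar> \<le> K"
  by (cases n) auto

lemma k_bounded_on_iter_deriv:
  assumes "k_bounded_on n K U f" "set vs \<subseteq> Basis" "length vs \<le> n" "x \<in> U"
  shows "\<bar>iter_deriv vs f x\<bar> \<le> K"
  using assms
proof (induction n arbitrary: f vs)
  case (Suc n)
  then show ?case
    by (cases vs rule: rev_cases) (auto simp: iter_deriv_append)
qed auto

lemma smooth_on_k_bounded_on:
  assumes "smooth_on U f"
    and "\<And>vs x. set vs \<subseteq> Basis \<Longrightarrow> length vs \<le> n \<Longrightarrow> x \<in> U \<Longrightarrow> \<bar>iter_deriv vs f x\<bar> \<le> K"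
  shows "k_bounded_on n K U f"
  using assms
proof (induction n arbitrary: f)
  case 0
  then show ?case using 0(2)[of "[]"] by simp
next
  case (Suc n)
  have "k_bounded_on n K U (\<lambda>x. frechet_derivative f (at x) v)" if v: "v \<in> Basis" for v
  proof (rule Suc.IH[OF smooth_on_partial[OF Suc.prems(1) v]])
    fix vs :: "'a list" and x
    assume "set vs \<subseteq> Basis" "length vs \<le> n" "x \<in> U"
    then show "\<bar>iter_deriv vs (\<lambda>x. frechet_derivative f (at x) v) x\<bar> \<le> K"
      using Suc.prems(2)[of "vs @ [v]" x] v by (simp add: iter_deriv_append)
  qed
  moreover have "\<bar>f x\<bar> \<le> K" if "x \<in> U" for x
    using Suc.prems(2)[of "[]" x] that by simp
  moreover have "f differentiable (at x)" if "x \<in> U" for x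
    using Suc.prems(1) that unfolding smooth_on_iff by (blast intro: k_smooth_on_differentiable)
  ultimately show ?case by simp
qed

lemma k_bounded_on_has_derivative:
  "k_bounded_on (Suc n) K U f \<Longrightarrow> x \<in> U \<Longrightarrow> (f has_derivative frechet_derivative f (at x)) (at x)"
  using frechet_derivative_works by auto

lemma k_bounded_on_cong:
  assumes "open U" "\<And>x. x \<in> U \<Longrightarrow> f x = g x" "k_bounded_on n K U f"
  shows "k_bounded_on n K U g"
  using assms(2,3)
proof (induction n arbitrary: f g)
  case (Suc n)
  have "k_bounded_on n K U (\<lambda>x. frechet_derivative g (at x) v)" if "v \<in> Basis" for v
    by (rule Suc.IH[where f = "\<lambda>x. frechet_derivative f (at x) v"])
      (use frechet_derivative_cong_open[OF assms(1), of _ f g] Suc.prems that in auto)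
  then show ?case
    using differentiable_cong_open[OF assms(1), of _ f g] Suc.prems by auto
qed auto

lemma k_bounded_on_SucI:
  assumes "open U" "\<And>x. x \<in> U \<Longrightarrow> (f has_derivative f' x) (at x)" "\<And>x. x \<in> U \<Longrightarrow> \<bar>f x\<bar> \<le> K"
    and "\<And>v. v \<in> Basis \<Longrightarrow> k_bounded_on n K U (\<lambda>x. f' x v)"
  shows "k_bounded_on (Suc n) K U f"
proof -
  have "k_bounded_on n K U (\<lambda>x. frechet_derivative f (at x) v)" if "v \<in> Basis" for v
    by (rule k_bounded_on_cong[OF assms(1) _ assms(4)[OF that]])
      (use frechet_derivative_at[OF assms(2)] in metis)
  then show ?thesis
    using assms(2,3) unfolding k_bounded_on.simps differentiable_def by blast
qed

lemma k_bounded_on_Suc: "k_bounded_on (Suc n) K U f \<Longrightarrow> k_bounded_on n K U f"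
  by (induction n arbitrary: f) auto

lemma k_bounded_on_mono:
  assumes "k_bounded_on n K U f" "V \<subseteq> U" "K \<le> L"
  shows "k_bounded_on n L V f"
  using assms
proof (induction n arbitrary: f)
  case 0
  then show ?case by fastforce
next
  case (Suc n)
  then show ?case by (auto simp: subset_iff) (meson order_trans)
qed

lemma k_bounded_on_const: "open U \<Longrightarrow> \<bar>c\<bar> \<le> K \<Longrightarrow> k_bounded_on n K U (\<lambda>x. c)"
proof (induction n arbitrary: c)
  case (Suc n)
  show ?case
    by (rule k_bounded_on_SucI[where f' = "\<lambda>x v. 0"]) (use Suc in auto)
qed simp

lemma k_bounded_on_add:
  assumes "open U" "k_bounded_on n K U f" "k_bounded_on n L U g"
  shows "k_bounded_on n (K + L) U (\<lambda>x. f x + g x)"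
  using assms(2,3)
proof (induction n arbitrary: f g)
  case 0
  then show ?case by fastforce
next
  case (Suc n)
  show ?case
  proof (rule k_bounded_on_SucI[OF assms(1) has_derivative_add])
    fix x assume x: "x \<in> U"
    show "(f has_derivative frechet_derivative f (at x)) (at x)"
      by (rule k_bounded_on_has_derivative[OF Suc.prems(1) x])
    show "(g has_derivative frechet_derivative g (at x)) (at x)"
      by (rule k_bounded_on_has_derivative[OF Suc.prems(2) x])
    show "\<bar>f x + g x\<bar> \<le> K + L"
      using k_bounded_on_bound[OF Suc.prems(1) x] k_bounded_on_bound[OF Suc.prems(2) x] by linarith
  next
    fix v :: 'a assume "v \<in> Basis"
    then show "k_bounded_on n (K + L) U
      (\<lambda>x. frechet_derivative f (at x) v + frechet_derivative g (at x) v)"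
      using Suc by simp
  qed
qed

text \<open>Each differentiation of a product doubles the number of terms, whence the factor
  2^n.\<close>

lemma k_bounded_on_mult:
  assumes "open U" "k_bounded_on n K U f" "k_bounded_on n L U g"
  shows "k_bounded_on n (2 ^ n * (K * L)) U (\<lambda>x. f x * g x)"
  using assms(2,3)
proof (induction n arbitrary: f g)
  case 0
  then show ?case by (auto simp: abs_mult intro!: mult_mono')
next
  case (Suc n)
  show ?case
  proof (rule k_bounded_on_SucI[OF assms(1) has_derivative_mult])
    fix x assume x: "x \<in> U"
    show "(f has_derivative frechet_derivative f (at x)) (at x)"
      by (rule k_bounded_on_has_derivative[OF Suc.prems(1) x])
    show "(g has_derivative frechet_derivative g (at x)) (at x)"
      by (rule k_bounded_on_has_derivative[OF Suc.prems(2) x])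
    have f: "\<bar>f x\<bar> \<le> K" and g: "\<bar>g x\<bar> \<le> L"
      using k_bounded_on_bound[OF Suc.prems(1) x] k_bounded_on_bound[OF Suc.prems(2) x] by auto
    have "\<bar>f x * g x\<bar> \<le> 1 * (K * L)"
      using f g by (auto simp: abs_mult intro!: mult_mono')
    also have "\<dots> \<le> 2 ^ Suc n * (K * L)"
      using f g by (intro mult_right_mono) (use one_le_power[of "2::real" "Suc n"] in auto)
    finally show "\<bar>f x * g x\<bar> \<le> 2 ^ Suc n * (K * L)" .
  next
    fix v :: 'a assume "v \<in> Basis"
    then show "k_bounded_on n (2 ^ Suc n * (K * L)) U
      (\<lambda>x. f x * frechet_derivative g (at x) v + frechet_derivative f (at x) v * g x)"
      using Suc.prems k_bounded_on_add[OF assms(1)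
          Suc.IH[of f "\<lambda>x. frechet_derivative g (at x) v"]
          Suc.IH[of "\<lambda>x. frechet_derivative f (at x) v" g]]
        k_bounded_on_Suc[OF Suc.prems(1)] k_bounded_on_Suc[OF Suc.prems(2)]
      by (simp add: mult_ac)
  qed
qed

lemma k_bounded_on_cmult:
  assumes "open U" "k_bounded_on n K U f"
  shows "k_bounded_on n (\<bar>c\<bar> * K) U (\<lambda>x. c * f x)"
  using assms(2)
proof (induction n arbitrary: f)
  case 0
  then show ?case by (auto simp: abs_mult intro!: mult_left_mono)
next
  case (Suc n)
  show ?case
  proof (rule k_bounded_on_SucI[OF assms(1) has_derivative_mult_right])
    fix x assume x: "x \<in> U"
    show "(f has_derivative frechet_derivative f (at x)) (at x)"
      by (rule k_bounded_on_has_derivative[OF Suc.prems(1) x])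
    show "\<bar>c * f x\<bar> \<le> \<bar>c\<bar> * K"
      using k_bounded_on_bound[OF Suc.prems(1) x] by (auto simp: abs_mult intro!: mult_left_mono)
  qed (use Suc in auto)
qed

lemma k_bounded_on_diff:
  assumes "open U" "k_bounded_on n K U f" "k_bounded_on n L U g"
  shows "k_bounded_on n (K + L) U (\<lambda>x. f x - g x)"
  using k_bounded_on_add[OF assms(1,2) k_bounded_on_cmult[OF assms(1,3), of "-1"]] by simp

lemma k_bounded_on_sum:
  assumes "open U" "finite I" "\<And>i. i \<in> I \<Longrightarrow> k_bounded_on n (K i) U (f i)"
  shows "k_bounded_on n (\<Sum>i\<in>I. K i) U (\<lambda>x. \<Sum>i\<in>I. f i x)"
  using assms(2,3) by (induction I rule: finite_induct)
    (auto intro!: k_bounded_on_add k_bounded_on_const assms(1))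

section \<open>Derivative bounds under composition with affine maps\<close>

lemma has_derivative_compose_affine:
  fixes l :: "'a::euclidean_space \<Rightarrow> 'c::euclidean_space" and h :: "'c \<Rightarrow> real"
  assumes "linear l" "(h has_derivative h') (at (c + l x))"
  shows "((\<lambda>x. h (c + l x)) has_derivative (\<lambda>v. \<Sum>e\<in>Basis. (l v \<bullet> e) * h' e)) (at x)"
proof -
  have l: "((\<lambda>x. c + l x) has_derivative l) (at x)"
    using assms(1) by (auto intro!: derivative_eq_intros linear_imp_has_derivative)
  have "(\<lambda>v. h' (l v)) = (\<lambda>v. \<Sum>e\<in>Basis. (l v \<bullet> e) * h' e)"
    using linear_eq_sum_Basis[OF has_derivative_linear[OF assms(2)]]
    by (intro ext) (metis (no_types, lifting) real_scaleR_def sum.cong)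
  then show ?thesis
    using has_derivative_compose[OF l assms(2)] by simp
qed

text \<open>\<open>M\<close> bounds the l1 norm of the image of a basis vector, that is, of the
  coefficients in the chain rule. Through it the scale of a chart and the slope of the cutoff enter
  the estimates.\<close>

lemma k_bounded_on_partial_compose_affine:
  fixes l :: "'a::euclidean_space \<Rightarrow> 'c::euclidean_space"
  assumes "open V" "\<And>e. e \<in> Basis \<Longrightarrow> k_bounded_on n K V (\<lambda>x. h e x)"
    and "(\<Sum>e\<in>Basis. \<bar>l v \<bullet> e\<bar>) \<le> M" "0 \<le> K"
  shows "k_bounded_on n (M * K) V (\<lambda>x. \<Sum>e\<in>Basis. (l v \<bullet> e) * h e x)"
proof (rule k_bounded_on_mono)
  show "k_bounded_on n (\<Sum>e\<in>Basis. \<bar>l v \<bullet> e\<bar> * K) V (\<lambda>x. \<Sum>e\<in>Basis. (l v \<bullet> e) * h e x)"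
    by (intro k_bounded_on_sum k_bounded_on_cmult assms finite_Basis)
  show "(\<Sum>e\<in>Basis. \<bar>l v \<bullet> e\<bar> * K) \<le> M * K"
    unfolding sum_distrib_right[symmetric] by (intro mult_right_mono assms)
qed simp

text \<open>A derivative of order k picks up M^k; the maximum with 1 covers all k up to
  \<open>n\<close> at once.\<close>

lemma k_bounded_on_compose_affine:
  fixes l :: "'a::euclidean_space \<Rightarrow> 'c::euclidean_space"
  assumes l: "linear l" "\<And>v. v \<in> Basis \<Longrightarrow> (\<Sum>e\<in>Basis. \<bar>l v \<bullet> e\<bar>) \<le> M"
    and V: "open V" "\<And>x. x \<in> V \<Longrightarrow> c + l x \<in> U"
    and h: "k_bounded_on n K U h" "0 \<le> K"
  shows "k_bounded_on n (max 1 M ^ n * K) V (\<lambda>x. h (c + l x))"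
  using h(1)
proof (induction n arbitrary: h)
  case 0
  then show ?case using V by auto
next
  case (Suc n)
  show ?case
  proof (rule k_bounded_on_SucI[OF V(1) has_derivative_compose_affine[OF l(1)]])
    fix x assume x: "x \<in> V"
    show "(h has_derivative frechet_derivative h (at (c + l x))) (at (c + l x))"
      by (rule k_bounded_on_has_derivative[OF Suc.prems V(2)[OF x]])
    have "\<bar>h (c + l x)\<bar> \<le> 1 * K"
      using k_bounded_on_bound[OF Suc.prems V(2)[OF x]] by simp
    also have "\<dots> \<le> max 1 M ^ Suc n * K"
      using h(2) by (intro mult_right_mono one_le_power) auto
    finally show "\<bar>h (c + l x)\<bar> \<le> max 1 M ^ Suc n * K" .
  next
    fix v :: 'a assume v: "v \<in> Basis"
    have "k_bounded_on n (max 1 M * (max 1 M ^ n * K)) V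
      (\<lambda>x. \<Sum>e\<in>Basis. (l v \<bullet> e) * frechet_derivative h (at (c + l x)) e)"
    proof (rule k_bounded_on_partial_compose_affine[OF V(1)])
      show "(\<Sum>e\<in>Basis. \<bar>l v \<bullet> e\<bar>) \<le> max 1 M" using l(2)[OF v] by simp
      show "k_bounded_on n (max 1 M ^ n * K) V (\<lambda>x. frechet_derivative h (at (c + l x)) e)"
        if "e \<in> Basis" for e
        using Suc.IH[of "\<lambda>y. frechet_derivative h (at y) e"] Suc.prems that by simp
    qed (use h in auto)
    then show "k_bounded_on n (max 1 M ^ Suc n * K) V
      (\<lambda>x. \<Sum>e\<in>Basis. (l v \<bullet> e) * frechet_derivative h (at (c + l x)) e)"
      by (simp add: mult.assoc)
  qed
qed

lemma k_bounded_on_compose_affine':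
  fixes l :: "'a::euclidean_space \<Rightarrow> 'c::euclidean_space"
  assumes l: "linear l" "\<And>v. v \<in> Basis \<Longrightarrow> (\<Sum>e\<in>Basis. \<bar>l v \<bullet> e\<bar>) \<le> 1"
    and V: "open V" "\<And>x. x \<in> V \<Longrightarrow> c + l x \<in> U"
    and h: "k_bounded_on n K U h" "0 \<le> K"
  shows "k_bounded_on n K V (\<lambda>x. h (c + l x))"
  using k_bounded_on_compose_affine[OF l V h] by simp

text \<open>Source of all smallness. Every derivative of positive order carries at least one factor
  \<open>M\<close>, and further ones are at most 1. The undifferentiated increment is of order
  \<open>M\<close> by the mean value inequality on the convex set \<open>V\<close>; the dimension
  comes from passing from partial derivatives to the operator norm.\<close>

lemma k_bounded_on_affine_increment:
  fixes l :: "'a::euclidean_space \<Rightarrow> 'c::euclidean_space" and K M D :: real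
  assumes l: "linear l" "\<And>v. v \<in> Basis \<Longrightarrow> (\<Sum>e\<in>Basis. \<bar>l v \<bullet> e\<bar>) \<le> M" "0 \<le> M" "M \<le> 1"
    and V: "open V" "convex V" "0 \<in> V" "\<And>x. x \<in> V \<Longrightarrow> norm x \<le> D"
      "\<And>x. x \<in> V \<Longrightarrow> c + l x \<in> U"
    and h: "k_bounded_on (Suc n) K U h" "0 \<le> K"
  shows "k_bounded_on (Suc n) (M * K * (1 + DIM('a) * D)) V (\<lambda>x. h (c + l x) - h c)"
proof -
  define f where "f = (\<lambda>x. h (c + l x))"
  define f' where "f' x v = (\<Sum>e\<in>Basis. (l v \<bullet> e) * frechet_derivative h (at (c + l x)) e)" for x v
  have D: "0 \<le> D" using V(3,4) norm_ge_zero order_trans by blast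
  have der: "(f has_derivative f' x) (at x)" if "x \<in> V" for x
    unfolding f_def f'_def
    by (intro has_derivative_compose_affine l k_bounded_on_has_derivative[OF h(1)] V that)
  have bd: "k_bounded_on n (M * K) V (\<lambda>x. f' x v)" if v: "v \<in> Basis" for v
    unfolding f'_def
  proof (rule k_bounded_on_partial_compose_affine[OF V(1)])
    show "(\<Sum>e\<in>Basis. \<bar>l v \<bullet> e\<bar>) \<le> M" "0 \<le> K" using l(2)[OF v] h(2) by auto
    fix e :: 'c assume "e \<in> Basis"
    have l1: "(\<Sum>e\<in>Basis. \<bar>l v \<bullet> e\<bar>) \<le> 1" if "v \<in> Basis" for v
      using l(2)[OF that] l(4) by simp
    show "k_bounded_on n K V (\<lambda>x. frechet_derivative h (at (c + l x)) e)"
      by (rule k_bounded_on_compose_affine'[OF l(1) l1 V(1,5) _ h(2)])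
        (use h(1) \<open>e \<in> Basis\<close> in auto)
  qed
  have on: "onorm (f' x) \<le> DIM('a) * (M * K)" if x: "x \<in> V" for x
  proof (rule onorm_le)
    fix v
    have "f' x v = (\<Sum>e\<in>Basis. (v \<bullet> e) *\<^sub>R f' x e)"
      by (rule linear_eq_sum_Basis[OF has_derivative_linear[OF der[OF x]]])
    also have "norm \<dots> \<le> (\<Sum>e\<in>(Basis::'a set). norm v * (M * K))"
      using k_bounded_on_bound[OF bd x]
      by (intro sum_norm_le) (auto simp: abs_mult Basis_le_norm intro!: mult_mono)
    finally show "norm (f' x v) \<le> DIM('a) * (M * K) * norm v" by (simp add: mult_ac)
  qed
  have val: "\<bar>f x - f 0\<bar> \<le> DIM('a) * (M * K) * D" if x: "x \<in> V" for x
  proof -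
    have "norm (f x - f 0) \<le> DIM('a) * (M * K) * norm (x - 0)"
      by (rule differentiable_bound[OF V(2) has_derivative_at_withinI[OF der] on])
        (use x V(3) in auto)
    also have "\<dots> \<le> DIM('a) * (M * K) * D"
      using V(4)[OF x] l(3) h(2) by (intro mult_left_mono) auto
    finally show ?thesis by simp
  qed
  have "f 0 = h c" using linear_0[OF l(1)] by (simp add: f_def)
  have "k_bounded_on (Suc n) (M * K * (1 + DIM('a) * D)) V (\<lambda>x. f x - f 0)"
  proof (rule k_bounded_on_SucI[OF V(1)])
    fix x assume x: "x \<in> V"
    show "((\<lambda>x. f x - f 0) has_derivative f' x) (at x)"
      using der[OF x] by (auto intro!: derivative_eq_intros)
    have "0 \<le> M * K" using l(3) h(2) by simp
    then show "\<bar>f x - f 0\<bar> \<le> M * K * (1 + DIM('a) * D)"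
      using val[OF x] by (simp add: algebra_simps)
  next
    fix v :: 'a assume "v \<in> Basis"
    then show "k_bounded_on n (M * K * (1 + DIM('a) * D)) V (\<lambda>x. f' x v)"
      by (rule k_bounded_on_mono[OF bd]) (use l(3) h(2) D in \<open>auto simp: algebra_simps\<close>)
  qed
  then show ?thesis using \<open>f 0 = h c\<close> by (simp add: f_def)
qed

section \<open>Translation between the norm and derivative bounds; the exponential and the
  cutoff\<close>

lemma C2_norm_le:
  assumes "\<And>i j. i \<in> Basis \<Longrightarrow> j \<in> Basis \<Longrightarrow> k_bounded_on 2 K U (\<lambda>x. h x i j)"
  shows "C2_norm U h \<le> ereal K"
  unfolding C2_norm_def
  by (rule SUP_least) (use assms in \<open>auto intro!: k_bounded_on_iter_deriv[of 2]\<close>)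

lemma k_bounded_on_C2_norm:
  assumes "C2_norm U h < ereal c" "smooth_on U (\<lambda>x. h x i j)" "i \<in> Basis" "j \<in> Basis"
  shows "k_bounded_on 2 c U (\<lambda>x. h x i j)"
proof (rule smooth_on_k_bounded_on[OF assms(2)])
  fix vs :: "'a list" and x assume "set vs \<subseteq> Basis" "length vs \<le> 2" "x \<in> U"
  then have "ereal \<bar>iter_deriv vs (\<lambda>y. h y i j) x\<bar> \<le> C2_norm U h"
    unfolding C2_norm_def using assms(3,4) by (intro SUP_upper2[of "(i, j, vs, x)"]) auto
  then show "\<bar>iter_deriv vs (\<lambda>y. h y i j) x\<bar> \<le> c"
    using assms(1) by (metis ereal_less_eq(3) less_imp_le order_trans)
qed

text \<open>Each derivative multiplies by \<alpha>, of size at most 2. Needed for e^(2t) in the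
  model metric and e^(-2t) in the error of the warping factor.\<close>

lemma k_bounded_on_exp:
  assumes "\<bar>\<alpha>\<bar> \<le> 2"
  shows "k_bounded_on n (2 ^ n * exp (2 * T)) {- T<..<T} (\<lambda>t. exp (\<alpha> * t))"
proof (induction n)
  case 0
  have "\<alpha> * t \<le> 2 * T" if "t \<in> {- T<..<T}" for t
  proof -
    have "\<alpha> * t \<le> \<bar>\<alpha>\<bar> * \<bar>t\<bar>" by (metis abs_ge_self abs_mult)
    also have "\<dots> \<le> 2 * T" using assms that by (intro mult_mono) auto
    finally show ?thesis .
  qed
  then show ?case by simp
next
  case (Suc n)
  show ?case
  proof (rule k_bounded_on_SucI)
    fix t assume t: "t \<in> {- T<..<T}"
    show "((\<lambda>t. exp (\<alpha> * t)) has_derivative (\<lambda>v. (v * \<alpha>) * exp (\<alpha> * t))) (at t)"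
      by (auto intro!: derivative_eq_intros)
    have "\<bar>exp (\<alpha> * t)\<bar> \<le> 2 ^ n * exp (2 * T)" using k_bounded_on_bound[OF Suc t] .
    also have "\<dots> \<le> 2 ^ Suc n * exp (2 * T)" by simp
    finally show "\<bar>exp (\<alpha> * t)\<bar> \<le> 2 ^ Suc n * exp (2 * T)" .
  next
    fix v :: real assume "v \<in> Basis"
    have "k_bounded_on n (\<bar>v * \<alpha>\<bar> * (2 ^ n * exp (2 * T))) {- T<..<T} (\<lambda>t. (v * \<alpha>) * exp (\<alpha> * t))"
      by (rule k_bounded_on_cmult[OF _ Suc]) simp
    then show "k_bounded_on n (2 ^ Suc n * exp (2 * T)) {- T<..<T} (\<lambda>t. (v * \<alpha>) * exp (\<alpha> * t))"
      by (rule k_bounded_on_mono) (use \<open>v \<in> Basis\<close> assms in auto)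
  qed simp
qed

lemma frechet_derivative_real:
  fixes f :: "real \<Rightarrow> real"
  assumes "f differentiable (at x)"
  shows "frechet_derivative f (at x) v = v * deriv f x"
proof -
  have "(f has_field_derivative deriv f x) (at x)"
    using assms DERIV_deriv_iff_real_differentiable by blast
  then have "frechet_derivative f (at x) = (*) (deriv f x)"
    unfolding has_field_derivative_def by (rule frechet_derivative_at[symmetric])
  then show ?thesis by (simp add: mult.commute)
qed

text \<open>12 is the largest of the bounds 1, 3 and 12 for the cutoff and its two derivatives. On
  the reals the only basis vector is 1, so three lists of directions have to be considered.\<close>

lemma warping_cutoff_k_bounded_on:
  assumes "warping_cutoff \<rho>"
  shows "k_bounded_on 2 12 UNIV \<rho>"
proof (rule smooth_on_k_bounded_on)
  show sm: "smooth_on UNIV \<rho>" using assms by (simp add: warping_cutoff_def)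
  have d0: "\<rho> differentiable (at x)" for x
    using smooth_on_has_derivative[OF sm, of x] by (auto simp: differentiable_def)
  then have e1: "iter_deriv [1] \<rho> = deriv \<rho>"
    using frechet_derivative_real[of \<rho>] by (simp add: fun_eq_iff)
  have "deriv \<rho> differentiable (at x)" for x
    using smooth_on_has_derivative[OF smooth_on_iter_deriv[OF sm, of "[1]"], of x] e1
    by (auto simp: differentiable_def)
  then have e2: "iter_deriv [1,1] \<rho> = deriv (deriv \<rho>)"
    using frechet_derivative_real[of "deriv \<rho>"] e1 by (simp add: fun_eq_iff)
  fix vs :: "real list" and x :: real assume vs: "set vs \<subseteq> Basis" "length vs \<le> 2"
  have "0 \<le> \<rho> x" "\<rho> x \<le> 1" "\<bar>deriv \<rho> x\<bar> < 3" "\<bar>deriv (deriv \<rho>) x\<bar> < 12"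
    using assms by (auto simp: warping_cutoff_def)
  moreover from vs have "vs = [] \<or> vs = [1] \<or> vs = [1,1]"
    by (cases vs rule: list.exhaust; cases "tl vs" rule: list.exhaust) (auto simp: numeral_2_eq_2)
  ultimately show "\<bar>iter_deriv vs \<rho> x\<bar> \<le> 12"
    using e1 e2 by (auto simp del: iter_deriv.simps(2))
qed

section \<open>The ball model in polar coordinates\<close>


text \<open>Termwise differentiation yields a power series again, with coefficients
  \<open>diffs c\<close>, convergent on the same ball; so the induction is general in
  \<open>c\<close>.\<close>

lemma k_smooth_on_powser:
  fixes c :: "nat \<Rightarrow> real"
  assumes "\<And>z. \<bar>z\<bar> < R \<Longrightarrow> summable (\<lambda>k. c k * z ^ k)"
  shows "k_smooth_on n (ball 0 R) (\<lambda>z. \<Sum>k. c k * z ^ k)"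
  using assms
proof (induction n arbitrary: c)
  case 0
  have "((\<lambda>z. \<Sum>k. c k * z ^ k) has_field_derivative (\<Sum>k. diffs c k * z ^ k)) (at z)"
    if "z \<in> ball 0 R" for z
    by (rule termdiffs_strong'[of R]) (use 0 that in auto)
  then show ?case
    unfolding k_smooth_on.simps using real_differentiable_def by blast
next
  case (Suc n)
  show ?case
  proof (rule k_smooth_on_SucI)
    fix z :: real assume "z \<in> ball 0 R"
    then have "((\<lambda>z. \<Sum>k. c k * z ^ k) has_field_derivative (\<Sum>k. diffs c k * z ^ k)) (at z)"
      by (intro termdiffs_strong'[of R]) (use Suc in auto)
    then show "((\<lambda>z. \<Sum>k. c k * z ^ k) has_derivative (\<lambda>v. v * (\<Sum>k. diffs c k * z ^ k))) (at z)"
      unfolding has_field_derivative_def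
      by (rule has_derivative_eq_rhs) (simp add: fun_eq_iff mult.commute)
  next
    fix v :: real
    have "k_smooth_on n (ball 0 R) (\<lambda>z. \<Sum>k. diffs c k * z ^ k)"
      by (rule Suc.IH) (use termdiff_converges[of _ R c] Suc.prems in auto)
    then show "k_smooth_on n (ball 0 R) (\<lambda>z. v * (\<Sum>k. diffs c k * z ^ k))"
      by (intro k_smooth_on_mult k_smooth_on_const) auto
  qed simp
qed

lemma smooth_on_ident: "open U \<Longrightarrow> smooth_on U (\<lambda>x. x)"
  using smooth_on_affine[OF linear_id, of U 0] by simp

text \<open>Even power series in the norm are power series in the smooth function \<open>x \<bullet> x\<close>.\<close>

lemma smooth_on_even_powser:
  fixes c :: "nat \<Rightarrow> real"
  assumes "\<And>r. 0 \<le> r \<Longrightarrow> r < R \<Longrightarrow> (\<lambda>k. c k * r ^ (2 * k)) sums h r"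
  shows "smooth_on (ball (0::'a::euclidean_space) R) (\<lambda>x. h (norm x))"
proof (cases "0 < R")
  case False
  then show ?thesis by (simp add: smooth_on_def ball_empty)
next
  case True
  have summ: "summable (\<lambda>k. c k * z ^ k)" if "\<bar>z\<bar> < R\<^sup>2" for z
  proof -
    have "sqrt \<bar>z\<bar> < R" using that True by (simp add: real_less_lsqrt)
    \<comment> \<open>The hypothesis gives convergence only at squares. Convergence at
      \<open>z\<close>, which may be negative, is absolute convergence inside the radius of the
      strictly larger point r^2.\<close>
    then obtain r where r: "sqrt \<bar>z\<bar> < r" "r < R" using dense by blast
    have r0: "0 \<le> r" using r(1) real_sqrt_ge_zero[of "\<bar>z\<bar>"] by linarith
    have "\<bar>z\<bar> < r\<^sup>2" using power_strict_mono[OF r(1), of 2] by simp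
    moreover have "summable (\<lambda>k. c k * (r\<^sup>2) ^ k)"
      using sums_summable[OF assms[OF r0 r(2)]] by (simp add: power_mult)
    ultimately show ?thesis
      by (intro powser_inside[of c "r\<^sup>2" z]) auto
  qed
  have "smooth_on (ball (0::'a) R) (\<lambda>x. \<Sum>k. c k * (x \<bullet> x) ^ k)"
  proof (rule smooth_on_compose[where V = "ball 0 (R\<^sup>2)" and f = "\<lambda>x. x \<bullet> x" and h = "\<lambda>z. \<Sum>k. c k * z ^ k"])
    have "x \<bullet> x < R\<^sup>2" if "norm x < R" for x :: 'a
      using that by (metis dot_square_norm norm_ge_zero power_strict_mono zero_less_numeral)
    then show "(\<lambda>x. x \<bullet> x) ` ball (0::'a) R \<subseteq> ball 0 (R\<^sup>2)" by auto
    show "smooth_on (ball (0::'a) R) (\<lambda>x. x \<bullet> x)"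
      by (intro smooth_on_bilinear[OF bounded_bilinear_inner] smooth_on_ident) auto
    show "smooth_on (ball 0 (R\<^sup>2)) (\<lambda>z. \<Sum>k. c k * z ^ k)"
      unfolding smooth_on_iff using summ by (auto intro!: k_smooth_on_powser)
  qed simp
  moreover have "(\<Sum>k. c k * (x \<bullet> x) ^ k) = h (norm x)" if "x \<in> ball 0 R" for x :: 'a
    using sums_unique[OF assms[of "norm x"]] that by (simp add: power_mult dot_square_norm)
  ultimately show ?thesis
    by (rule smooth_on_cong[OF open_ball, rotated]) auto
qed

lemma smooth_on_odd_powser:
  fixes c :: "nat \<Rightarrow> real"
  assumes "\<And>r. 0 \<le> r \<Longrightarrow> r < R \<Longrightarrow> (\<lambda>k. c k * r ^ (2 * k + 1)) sums h r"
  shows "smooth_on (ball (0::'a::euclidean_space) R) (\<lambda>x. (h (norm x) / norm x) *\<^sub>R x)"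
proof -
  \<comment> \<open>The even series has the value \<open>c 0\<close> at 0, while
    \<open>h r / r\<close> is 0 there by the convention on division. The difference disappears after
    multiplication by the vector \<open>x\<close>.\<close>
  define h' where "h' r = (if r = 0 then c 0 else h r / r)" for r :: real
  have "(\<lambda>k. c k * r ^ (2 * k)) sums h' r" if r: "0 \<le> r" "r < R" for r
  proof (cases "r = 0")
    case True
    have "(\<lambda>k. c k * 0 ^ k) sums c 0" by (rule powser_sums_zero)
    then show ?thesis using True by (simp add: h'_def power_mult)
  next
    case False
    then show ?thesis
      using sums_divide[OF assms[OF r], of r] by (simp add: h'_def)
  qed
  then have "smooth_on (ball (0::'a) R) (\<lambda>x. h' (norm x))"
    by (rule smooth_on_even_powser)
  then have "smooth_on (ball (0::'a) R) (\<lambda>x. h' (norm x) *\<^sub>R x)"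
    by (intro smooth_on_bilinear[OF bounded_bilinear_scaleR] smooth_on_ident) auto
  then show ?thesis
    by (rule smooth_on_cong[OF open_ball, rotated]) (simp add: h'_def)
qed

lemma smooth_on_inverse:
  fixes f :: "'a::euclidean_space \<Rightarrow> real"
  shows "open U \<Longrightarrow> (\<And>x. x \<in> U \<Longrightarrow> f x \<noteq> 0) \<Longrightarrow> smooth_on U f \<Longrightarrow> smooth_on U (\<lambda>x. inverse (f x))"
  using k_smooth_on_inverse unfolding smooth_on_iff by blast

lemma odd_sums_sinh: "(\<lambda>k. x ^ (2 * k + 1) / fact (2 * k + 1)) sums sinh (x::real)"
proof -
  have "(\<lambda>k. (\<lambda>n. if even n then 0 else x ^ n /\<^sub>R fact n) (2 * k + 1)) sums sinh x"
    by (subst sums_mono_reindex) (auto intro!: sinh_converges strict_monoI elim: oddE)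
  then show ?thesis by (simp add: field_simps)
qed

lemma even_sums_cosh: "(\<lambda>k. x ^ (2 * k) / fact (2 * k)) sums cosh (x::real)"
proof -
  have "(\<lambda>k. (\<lambda>n. if even n then x ^ n /\<^sub>R fact n else 0) (2 * k)) sums cosh x"
    by (subst sums_mono_reindex) (auto intro!: cosh_converges strict_monoI elim: evenE)
  then show ?thesis by (simp add: field_simps)
qed

text \<open>Half the difference of the series for ln(1 + x) and ln(1 - x), in which the even terms
  cancel.\<close>

lemma odd_sums_artanh:
  assumes "\<bar>x\<bar> < 1"
  shows "(\<lambda>k. x ^ (2 * k + 1) / real (2 * k + 1)) sums artanh x"
proof -
  have "(\<lambda>n. (- ((- x) ^ n) / real n - - ((- (- x)) ^ n) / real n) / 2) sums
      ((ln (1 + x) - ln (1 + - x)) / 2)"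
    using assms by (intro sums_divide sums_diff ln_series') auto
  moreover have "(ln (1 + x) - ln (1 + - x)) / 2 = artanh x"
    using assms by (auto simp: artanh_def ln_div)
  moreover have "(\<lambda>n. (- ((- x) ^ n) / real n - - ((- (- x)) ^ n) / real n) / 2) =
     (\<lambda>n. if even n then 0 else x ^ n / real n)"
    by auto
  ultimately have "(\<lambda>n. if even n then 0 else x ^ n / real n) sums artanh x" by simp
  then have "(\<lambda>k. (\<lambda>n. if even n then 0 else x ^ n / real n) (2 * k + 1)) sums artanh x"
    by (subst sums_mono_reindex) (auto intro!: strict_monoI elim: oddE)
  then show ?thesis by simp
qed

lemma tanh_artanh_real:
  assumes "\<bar>x::real\<bar> < 1"
  shows "tanh (artanh x) = x"
proof -
  have "exp (- 2 * artanh x) = (1 - x) / (1 + x)"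
    using assms by (simp add: artanh_def exp_minus)
  moreover have "(1 - (1 - x) / (1 + x)) / (1 + (1 - x) / (1 + x)) = x"
    using assms by (simp add: field_simps)
  ultimately show ?thesis
    unfolding tanh_real_altdef by metis
qed

text \<open>The exponential map of the ball model at its centre, in an orthonormal frame: a
  hyperbolic sphere of radius r around the centre has Euclidean radius tanh(r/2).\<close>

definition ball_map :: "'b::euclidean_space \<Rightarrow> 'b" where
  "ball_map x = (tanh (norm x / 2) / norm x) *\<^sub>R x"

definition ball_map_inv :: "'b::euclidean_space \<Rightarrow> 'b" where
  "ball_map_inv y = (2 * artanh (norm y) / norm y) *\<^sub>R y"

text \<open>The power series of tanh(r/2) converges only for r < pi. Written as sinh over cosh, the
  map involves two everywhere convergent series and a denominator without zeros, so every radius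
  \<open>R\<close> is reached.\<close>

lemma smooth_on_ball_map: "smooth_on (ball 0 R) (ball_map :: 'b::euclidean_space \<Rightarrow> 'b)"
proof -
  have 1: "smooth_on (ball (0::'b) R) (\<lambda>x. (sinh (norm x / 2) / norm x) *\<^sub>R x)"
  proof (rule smooth_on_odd_powser)
    fix r :: real
    show "(\<lambda>k. ((1 / 2) ^ (2 * k + 1) / fact (2 * k + 1)) * r ^ (2 * k + 1)) sums sinh (r / 2)"
      using odd_sums_sinh[of "r / 2"] by (simp add: power_divide field_simps)
  qed
  have 2: "smooth_on (ball (0::'b) R) (\<lambda>x. cosh (norm x / 2))"
  proof (rule smooth_on_even_powser)
    fix r :: real
    show "(\<lambda>k. ((1 / 2) ^ (2 * k) / fact (2 * k)) * r ^ (2 * k)) sums cosh (r / 2)"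
      using even_sums_cosh[of "r / 2"] by (simp add: power_divide field_simps)
  qed
  have "smooth_on (ball (0::'b) R)
      (\<lambda>x. inverse (cosh (norm x / 2)) *\<^sub>R ((sinh (norm x / 2) / norm x) *\<^sub>R x))"
    by (intro smooth_on_bilinear[OF bounded_bilinear_scaleR] smooth_on_inverse 1 2) auto
  then show ?thesis
    by (rule smooth_on_cong[OF open_ball, rotated]) (simp add: ball_map_def tanh_def field_simps)
qed

lemma smooth_on_ball_map_inv: "smooth_on (ball 0 1) ball_map_inv"
  unfolding ball_map_inv_def
proof (rule smooth_on_odd_powser)
  fix r :: real assume "0 \<le> r" "r < 1"
  then show "(\<lambda>k. 2 / real (2 * k + 1) * r ^ (2 * k + 1)) sums (2 * artanh r)"
    using sums_mult[OF odd_sums_artanh[of r], of 2] by simp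
qed

section \<open>The radial map as a diffeomorphism between balls\<close>

lemma norm_ball_map: "norm (ball_map x) = tanh (norm x / 2)"
  by (simp add: ball_map_def)

lemma ball_map_inv_ball_map: "ball_map_inv (ball_map x) = x"
  by (simp add: ball_map_inv_def norm_ball_map artanh_tanh_real) (simp add: ball_map_def)

lemma ball_map_ball_map_inv:
  assumes "norm y < 1"
  shows "ball_map (ball_map_inv y) = y"
proof -
  have "0 \<le> artanh (norm y)"
    using tanh_artanh_real[of "norm y"] assms by (metis abs_norm_cancel norm_ge_zero tanh_real_nonneg_iff)
  then have "norm (ball_map_inv y) = 2 * artanh (norm y)"
    by (auto simp: ball_map_inv_def)
  moreover have "artanh (norm y) \<noteq> 0" if "y \<noteq> 0"
    using tanh_artanh_real[of "norm y"] assms that by auto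
  ultimately show ?thesis
    using tanh_artanh_real[of "norm y"] assms
    by (cases "y = 0") (simp_all add: ball_map_def ball_map_inv_def)
qed

lemma image_ball_map: "ball_map ` ball 0 a = ball 0 (tanh (a / 2))"
proof -
  have "y \<in> ball_map ` ball 0 a" if y: "norm y < tanh (a / 2)" for y :: 'a
  proof (rule image_eqI)
    have "norm y < 1" using y tanh_real_lt_1[of "a / 2"] by linarith
    then show eq: "y = ball_map (ball_map_inv y)" by (simp add: ball_map_ball_map_inv)
    then have "norm y = tanh (norm (ball_map_inv y) / 2)" by (metis norm_ball_map)
    then show "ball_map_inv y \<in> ball 0 a" using y by simp
  qed
  then show ?thesis by (auto simp: norm_ball_map)
qed

lemma diffeo_ball_map: "diffeo_onto_open (ball 0 a) ball_map"
  unfolding diffeo_onto_open_def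
proof (intro conjI)
  show inj: "inj_on ball_map (ball (0::'a) a)"
    by (metis ball_map_inv_ball_map inj_onI)
  show "open (ball_map ` ball (0::'a) a)" by (simp add: image_ball_map)
  have sub: "ball_map ` ball (0::'a) a \<subseteq> ball 0 1"
    using tanh_real_lt_1[of "a / 2"] by (auto simp: image_ball_map)
  show "smooth_on (ball_map ` ball (0::'a) a) (the_inv_into (ball 0 a) ball_map)"
  proof (rule smooth_on_cong)
    show "smooth_on (ball_map ` ball (0::'a) a) ball_map_inv"
      by (rule smooth_on_subset[OF smooth_on_ball_map_inv sub])
    show "ball_map_inv y = the_inv_into (ball 0 a) ball_map y" if "y \<in> ball_map ` ball (0::'a) a" for y
      using that by (auto simp: ball_map_inv_ball_map the_inv_into_f_f[OF inj])
  qed (simp add: image_ball_map)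
qed (auto simp: smooth_on_ball_map)

text \<open>The derivative exists by smoothness, so it can be read off along lines. Along t v the
  map is tanh(t |v| / 2)/|v| times v, for negative t as well because tanh is odd. The factor 1/2
  compensates the factor 4 of the Poincare metric at the centre.\<close>

lemma ball_map_derivative_zero: "frechet_derivative ball_map (at 0) v = v /\<^sub>R 2"
proof -
  let ?D = "frechet_derivative ball_map (at (0::'a))"
  have D: "(ball_map has_derivative ?D) (at 0)"
    by (rule smooth_on_has_derivative[OF smooth_on_ball_map[of 1]]) simp
  show ?thesis
  proof (cases "v = 0")
    case True
    then show ?thesis using has_derivative_linear[OF D] by (simp add: linear_0)
  next
    case False
    have eq: "ball_map (t *\<^sub>R v) = (tanh (t * norm v / 2) / norm v) *\<^sub>R v" for t
    proof (cases "t \<ge> 0")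
      case t: False
      then have "tanh (- (t * norm v) / 2) = - tanh (t * norm v / 2)"
        by (metis minus_divide_left tanh_minus)
      then show ?thesis using False t by (simp add: ball_map_def)
    qed (use False in \<open>auto simp: ball_map_def\<close>)
    have "((\<lambda>t. ball_map (t *\<^sub>R v)) has_derivative (\<lambda>t. ?D (t *\<^sub>R v))) (at 0)"
      by (rule has_derivative_compose[where g = ball_map]) (use D in \<open>auto intro!: derivative_eq_intros\<close>)
    moreover have "((\<lambda>t. ball_map (t *\<^sub>R v)) has_derivative (\<lambda>t. (t / 2) *\<^sub>R v)) (at 0)"
    proof -
      have "((\<lambda>t. tanh (t * norm v / 2) / norm v) has_real_derivative 1 / 2) (at 0)"
        using False by (auto intro!: derivative_eq_intros)
      then have "((\<lambda>t. tanh (t * norm v / 2) / norm v) has_derivative (\<lambda>t. t / 2)) (at 0)"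
        unfolding has_field_derivative_def by (rule has_derivative_eq_rhs) (simp add: fun_eq_iff)
      then show ?thesis unfolding eq by (rule has_derivative_scaleR_left)
    qed
    ultimately have "(\<lambda>t. ?D (t *\<^sub>R v)) = (\<lambda>t. (t / 2) *\<^sub>R v)"
      by (rule has_derivative_unique)
    from fun_cong[OF this, of 1] show ?thesis by simp
  qed
qed

section \<open>Comparison of the deformed metric with the Poincare metric away from the
  origin\<close>

lemma has_derivative_norm_inner:
  fixes y :: "'a::euclidean_space"
  assumes "y \<noteq> 0"
  shows "(norm has_derivative (\<lambda>v. (y \<bullet> v) / norm y)) (at y)"
proof -
  have "((\<lambda>x. sqrt (x \<bullet> x)) has_derivative (\<lambda>v. (y \<bullet> v) / norm y)) (at y)"
    using assms
    by (auto intro!: derivative_eq_intros simp: norm_eq_sqrt_inner inner_commute field_simps)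
  then show ?thesis by (simp add: norm_eq_sqrt_inner[abs_def])
qed

lemma ball_map_derivative:
  assumes "y \<noteq> 0"
  defines "r \<equiv> norm y" and "T \<equiv> tanh (norm y / 2)"
  shows "frechet_derivative ball_map (at y) v =
    (T / r) *\<^sub>R v + (((1 - T\<^sup>2) / (2 * r) - T / r\<^sup>2) * (y \<bullet> v) / r) *\<^sub>R y"
proof -
  have r: "r > 0" using assms by (simp add: r_def)
  have "((\<lambda>s. tanh (s / 2) / s) has_real_derivative ((1 - T\<^sup>2) / (2 * r) - T / r\<^sup>2)) (at (norm y))"
    using r by (auto intro!: derivative_eq_intros simp: T_def r_def field_simps power2_eq_square)
  note DERIV_compose_FDERIV[OF this has_derivative_norm_inner[OF assms(1)]]
  from has_derivative_scaleR[OF this has_derivative_ident]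
  have "(ball_map has_derivative (\<lambda>v. (T / r) *\<^sub>R v +
      (((1 - T\<^sup>2) / (2 * r) - T / r\<^sup>2) * (y \<bullet> v) / r) *\<^sub>R y)) (at y)"
    unfolding ball_map_def[abs_def]
    by (rule has_derivative_eq_rhs) (simp add: fun_eq_iff T_def r_def mult.commute)
  then show ?thesis by (simp flip: frechet_derivative_at)
qed

text \<open>The first component is the part of \<open>v\<close> orthogonal to \<open>y\<close>,
  divided by |y|; the second is the radial component.\<close>

lemma polar_derivative:
  assumes "y \<noteq> 0"
  shows "frechet_derivative polar (at y) v =
    (v /\<^sub>R norm y - ((y \<bullet> v) / norm y ^ 3) *\<^sub>R y, (y \<bullet> v) / norm y)"
proof -
  have "((\<lambda>s. inverse s) has_real_derivative - (1 / (norm y)\<^sup>2)) (at (norm y))"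
    using assms by (auto intro!: derivative_eq_intros simp: field_simps power2_eq_square)
  note DERIV_compose_FDERIV[OF this has_derivative_norm_inner[OF assms]]
  from has_derivative_Pair[OF has_derivative_scaleR[OF this has_derivative_ident]
      has_derivative_norm_inner[OF assms]]
  have "(polar has_derivative (\<lambda>v. (v /\<^sub>R norm y - ((y \<bullet> v) / norm y ^ 3) *\<^sub>R y, (y \<bullet> v) / norm y))) (at y)"
    unfolding polar_def[abs_def]
  proof (rule has_derivative_eq_rhs, intro ext)
    fix v
    have "(y \<bullet> v) / norm y * - (1 / (norm y)\<^sup>2) = - ((y \<bullet> v) / norm y ^ 3)"
      by (simp add: power2_eq_square power3_eq_cube)
    then show "(inverse (norm y) *\<^sub>R v + ((y \<bullet> v) / norm y * - (1 / (norm y)\<^sup>2)) *\<^sub>R y, (y \<bullet> v) / norm y)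
      = (v /\<^sub>R norm y - ((y \<bullet> v) / norm y ^ 3) *\<^sub>R y, (y \<bullet> v) / norm y)"
      by (simp only: scaleR_minus_left diff_conv_add_uminus)
  qed
  then show ?thesis by (simp flip: frechet_derivative_at)
qed

text \<open>With T = tanh(r/2), the right side is the Euclidean radius T times the conformal factor
  2/(1 - T^2). This identity makes the spherical parts of the two metrics agree.\<close>

lemma sinh_real_half_tanh: "sinh (r::real) = 2 * tanh (r / 2) / (1 - (tanh (r / 2))\<^sup>2)"
proof -
  have "sinh r = 2 * sinh (r / 2) * cosh (r / 2)" using sinh_double[of "r / 2"] by simp
  moreover have "1 - (tanh (r / 2))\<^sup>2 = 1 / (cosh (r / 2))\<^sup>2"
    using hyperbolic_pythagoras[of "r / 2"] cosh_real_nonzero[of "r / 2"]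
    by (simp add: tanh_def power_divide diff_divide_eq_iff del: cosh_real_nonzero)
  ultimately show ?thesis by (simp add: tanh_def power2_eq_square)
qed

text \<open>Inside radius \<open>a\<close> the cutoff vanishes and only the round metric is left.
  Away from 0 both sides are combinations of v . w and (y . v)(y . w), with coefficients depending
  on |y|; these coefficients are compared.\<close>

lemma warped_space_eq_pullback_poincare:
  fixes g :: "'b::euclidean_space tensor2"
  assumes "warping_cutoff \<rho>" "0 < d" "norm y < a"
  shows "warped_space \<rho> a d g y v w = pullback ball_map poincare_metric y v w"
proof (cases "y = 0")
  case True
  then show ?thesis
    by (simp add: warped_space_def pullback_def poincare_metric_def ball_map_derivative_zero norm_ball_map)
next
  case False
  define r where "r = norm y"
  define T where "T = tanh (r / 2)"
  define q where "q = 1 - T\<^sup>2"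
  have r: "r > 0" using False by (simp add: r_def)
  have q: "q > 0"
    using tanh_real_bounds[of "r / 2"] by (simp add: q_def T_def abs_square_less_1 abs_if)
  have yy: "y \<bullet> y = r\<^sup>2" by (simp add: r_def dot_square_norm)
  have sh: "sinh r = 2 * T / q" unfolding q_def T_def by (rule sinh_real_half_tanh)
  have "2 * ((r - a) / d) \<le> 0" using assms by (simp add: r_def divide_le_0_iff)
  then have "\<rho> (2 * ((r - a) / d)) = 0" using assms(1) by (simp add: warping_cutoff_def)
  then have "warped_space \<rho> a d g y v w =
     (sinh r)\<^sup>2 * ((v /\<^sub>R r - ((y \<bullet> v) / r ^ 3) *\<^sub>R y) \<bullet> (w /\<^sub>R r - ((y \<bullet> w) / r ^ 3) *\<^sub>R y))
       + (y \<bullet> v) / r * ((y \<bullet> w) / r)"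
    using False
    by (simp add: warped_space_def pullback_def polar_derivative warped_def radial_metric_def
        deformed_family_def round_metric_def polar_def r_def)
  also have "\<dots> = 4 * T\<^sup>2 / q\<^sup>2 * ((v \<bullet> w) / r\<^sup>2 - (y \<bullet> v) * (y \<bullet> w) / r ^ 4)
       + (y \<bullet> v) * (y \<bullet> w) / r\<^sup>2"
  proof -
    have "(v /\<^sub>R r - ((y \<bullet> v) / r ^ 3) *\<^sub>R y) \<bullet> (w /\<^sub>R r - ((y \<bullet> w) / r ^ 3) *\<^sub>R y)
      = (v \<bullet> w) / r\<^sup>2 - 2 * (y \<bullet> v) * (y \<bullet> w) / r ^ 4 + (y \<bullet> v) * (y \<bullet> w) * (y \<bullet> y) / r ^ 6"
      by (simp add: inner_diff_left inner_diff_right inner_commute[of v y] algebra_simps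
          divide_inverse power_inverse power_add[symmetric] eval_nat_numeral)
    also have "\<dots> = (v \<bullet> w) / r\<^sup>2 - (y \<bullet> v) * (y \<bullet> w) / r ^ 4"
      using r unfolding yy by (simp add: field_simps eval_nat_numeral)
    finally show ?thesis
      unfolding sh by (simp add: power_divide power_mult_distrib power2_eq_square)
  qed
  also have "\<dots> = 4 * (((T / r) *\<^sub>R v + ((q / (2 * r) - T / r\<^sup>2) * (y \<bullet> v) / r) *\<^sub>R y) \<bullet>
      ((T / r) *\<^sub>R w + ((q / (2 * r) - T / r\<^sup>2) * (y \<bullet> w) / r) *\<^sub>R y)) / q\<^sup>2"
  proof -
    define k where "k = (q / (2 * r) - T / r\<^sup>2) / r"
    \<comment> \<open>The derivative of \<open>ball_map\<close> stretches the direction of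
      \<open>y\<close> by T/r + k r^2 = q/2, the derivative of tanh(s/2) at s = r. Squaring this and
      dividing by r^2 gives the identity.\<close>
    have "2 * (T / r) * k + k\<^sup>2 * r\<^sup>2 = q\<^sup>2 / (4 * r\<^sup>2) - T\<^sup>2 / r ^ 4"
      unfolding k_def using r by (simp add: field_simps eval_nat_numeral)
    moreover have "((T / r) *\<^sub>R v + (k * (y \<bullet> v)) *\<^sub>R y) \<bullet> ((T / r) *\<^sub>R w + (k * (y \<bullet> w)) *\<^sub>R y)
      = (T / r)\<^sup>2 * (v \<bullet> w) + (2 * (T / r) * k + k\<^sup>2 * r\<^sup>2) * ((y \<bullet> v) * (y \<bullet> w))"
      by (simp add: inner_add_left inner_add_right inner_commute[of v y] yy algebra_simps
          power2_eq_square)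
    ultimately have "((T / r) *\<^sub>R v + (k * (y \<bullet> v)) *\<^sub>R y) \<bullet> ((T / r) *\<^sub>R w + (k * (y \<bullet> w)) *\<^sub>R y)
      = (T / r)\<^sup>2 * (v \<bullet> w) + (q\<^sup>2 / (4 * r\<^sup>2) - T\<^sup>2 / r ^ 4) * ((y \<bullet> v) * (y \<bullet> w))"
      by simp
    moreover have "4 * T\<^sup>2 / q\<^sup>2 * (A / r\<^sup>2 - P / r ^ 4) + P / r\<^sup>2 =
        4 * ((T / r)\<^sup>2 * A + (q\<^sup>2 / (4 * r\<^sup>2) - T\<^sup>2 / r ^ 4) * P) / q\<^sup>2" for A P
      using r q by (simp add: field_simps eval_nat_numeral)
    moreover have "(q / (2 * r) - T / r\<^sup>2) * u / r = k * u" for u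
      by (simp add: k_def)
    ultimately show ?thesis by (simp only: mult.assoc)
  qed
  also have "\<dots> = pullback ball_map poincare_metric y v w"
    using ball_map_derivative[OF False]
    by (simp add: pullback_def poincare_metric_def norm_ball_map r_def T_def q_def)
  finally show ?thesis .
qed

lemma hyperbolic_on_warped_space:
  fixes g :: "'b::euclidean_space tensor2"
  assumes "warping_cutoff \<rho>" "0 < d"
  shows "hyperbolic_on (ball 0 a) (warped_space \<rho> a d g)"
  unfolding hyperbolic_on_def
proof
  fix x :: 'b assume x: "x \<in> ball 0 a"
  have "ball_map ` ball (0::'b) a \<subseteq> ball 0 1"
    using tanh_real_lt_1[of "a / 2"] by (auto simp: image_ball_map)
  then show "\<exists>N (F :: 'b \<Rightarrow> 'b). x \<in> N \<and> N \<subseteq> ball 0 a \<and> diffeo_onto_open N F \<and> F ` N \<subseteq> ball 0 1 \<and>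
        (\<forall>y\<in>N. \<forall>v w. warped_space \<rho> a d g y v w = pullback F poincare_metric y v w)"
    using x diffeo_ball_map[where 'a='b] warped_space_eq_pullback_poincare[OF assms, where 'b='b]
    by (intro exI[of _ "ball 0 a"] exI[of _ ball_map]) auto
qed

section \<open>Metrics in charts\<close>


lemma bilinear_eq_sum_Basis:
  fixes m :: "'a::euclidean_space \<Rightarrow> 'a \<Rightarrow> real"
  assumes "bilinear m"
  shows "m v w = (\<Sum>i\<in>Basis. \<Sum>j\<in>Basis. (v \<bullet> i) * (w \<bullet> j) * m i j)"
proof -
  have 1: "linear (\<lambda>v. m v w)" for w using assms by (simp add: bilinear_def)
  have 2: "linear (m v)" for v using assms by (simp add: bilinear_def)
  have "m v w = (\<Sum>i\<in>Basis. (v \<bullet> i) *\<^sub>R m i w)" by (rule linear_eq_sum_Basis[OF 1])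
  also have "\<dots> = (\<Sum>i\<in>Basis. (v \<bullet> i) *\<^sub>R (\<Sum>j\<in>Basis. (w \<bullet> j) *\<^sub>R m i j))"
    by (subst linear_eq_sum_Basis[OF 2, of _ w]) simp
  finally show ?thesis by (simp add: sum_distrib_left mult.assoc)
qed

text \<open>The standard basis serves as index set, and the frame grows by one vector at a time. A
  vector orthogonal to the earlier ones is found by counting dimensions instead of
  projecting.\<close>

lemma exists_orthonormal_frame:
  fixes m :: "'a::euclidean_space \<Rightarrow> 'a \<Rightarrow> real"
  assumes m: "bilinear m" "\<And>v w. m v w = m w v" "\<And>v. v \<noteq> 0 \<Longrightarrow> m v v > 0"
    and "(I :: 'a set) \<subseteq> Basis"
  shows "\<exists>b. \<forall>i\<in>I. \<forall>j\<in>I. m (b i) (b j) = (if i = j then 1 else 0)"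
proof -
  have lin: "linear (m v)" for v using m(1) by (simp add: bilinear_def)
  have "finite I" using assms(4) finite_Basis finite_subset by blast
  then show ?thesis using assms(4)
  proof (induction I)
    case (insert k I)
    then obtain b where b: "\<And>i j. i \<in> I \<Longrightarrow> j \<in> I \<Longrightarrow> m (b i) (b j) = (if i = j then 1 else 0)"
      by auto
    \<comment> \<open>The linear map \<open>T\<close> misses \<open>k\<close>, so it has a kernel: a direction orthogonal to the frame so far.\<close>
    define T where "T v = (\<Sum>i\<in>I. m (b i) v *\<^sub>R i)" for v
    have "linear T" unfolding T_def
      by (intro linear_compose_sum ballI linear_compose_scale_right[OF lin, unfolded o_def] linearI)
        (simp_all add: linear_add[OF lin] linear_cmul[OF lin] scaleR_add_left)
    have Tk: "T v \<bullet> k = 0" for v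
      using insert.hyps insert.prems by (auto simp: T_def inner_sum_left inner_Basis intro!: sum.neutral)
    have "\<not> surj T"
    proof
      assume "surj T"
      then obtain v where "T v = k" by (metis surjD)
      then show False using Tk[of v] insert.prems by (auto simp: inner_Basis)
    qed
    then have "\<not> inj T" using linear_inj_imp_surj[OF \<open>linear T\<close>] by blast
    then obtain v where v: "T v = 0" "v \<noteq> 0"
      using \<open>linear T\<close> linear_injective_0 by blast
    have orth: "m (b i) v = 0" if "i \<in> I" for i
    proof -
      have "T v \<bullet> i = m (b i) v * (i \<bullet> i)"
        using insert.hyps(1) insert.prems that
        by (simp add: T_def inner_sum_left inner_Basis subset_iff if_distrib[where f="\<lambda>x. _ * x"] cong: if_cong)
      then show ?thesis using v(1) insert.prems that by (auto simp: inner_Basis)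
    qed
    define u where "u = v /\<^sub>R sqrt (m v v)"
    have lin': "linear (\<lambda>v. m v w)" for w using m(1) by (simp add: bilinear_def)
    have "m u u = 1"
      using m(3)[OF v(2)] by (simp add: u_def linear_cmul[OF lin] linear_cmul[OF lin'] field_simps)
    moreover have "m (b i) u = 0" "m u (b i) = 0" if "i \<in> I" for i
      using orth[OF that] m(2)[of u] by (simp_all add: u_def linear_cmul[OF lin])
    ultimately show ?case
      using b insert.hyps(2) by (intro exI[of _ "b(k := u)"]) auto
  qed simp
qed

text \<open>\<open>B\<close> sends the standard basis to an m-orthonormal frame. Its size is
  controlled by l |B v|^2 <= m (B v) (B v) = |v|^2, so the lower bound on the metric becomes an
  upper bound on the frame.\<close>

lemma exists_isometric_frame:
  fixes m :: "'a::euclidean_space \<Rightarrow> 'a \<Rightarrow> real"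
  assumes m: "bilinear m" "\<And>v w. m v w = m w v"
    and l: "0 < l" "\<And>v. l * (v \<bullet> v) \<le> m v v"
  shows "\<exists>B :: 'a \<Rightarrow> 'a. linear B \<and> (\<forall>v w. m (B v) (B w) = v \<bullet> w) \<and>
    (\<forall>v. norm (B v) \<le> norm v / sqrt l)"
proof -
  have pos: "m v v > 0" if "v \<noteq> 0" for v
    using l(2)[of v] l(1) that by (smt (verit) inner_gt_zero_iff mult_pos_pos)
  have "\<exists>b. \<forall>i\<in>(Basis :: 'a set). \<forall>j\<in>Basis. m (b i) (b j) = (if i = j then 1 else 0)"
    by (rule exists_orthonormal_frame) (use m pos in auto)
  then obtain b where b: "\<And>i j :: 'a. i \<in> Basis \<Longrightarrow> j \<in> Basis \<Longrightarrow> m (b i) (b j) = (if i = j then 1 else 0)"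
    by blast
  define B where "B v = (\<Sum>e\<in>Basis. (v \<bullet> e) *\<^sub>R b e)" for v
  have B: "linear B"
    unfolding B_def by (rule linearI) (simp_all add: inner_add_left scaleR_add_left sum.distrib scaleR_sum_right)
  have Bb: "B e = b e" if "e \<in> Basis" for e
    using that by (simp add: B_def inner_Basis if_distrib[where f="\<lambda>x. x *\<^sub>R _"] cong: if_cong)
  have iso: "m (B v) (B w) = v \<bullet> w" for v w
  proof -
    have "bilinear (\<lambda>v w. m (B v) (B w))"
      using m(1) B unfolding bilinear_def by (auto intro: linear_compose[unfolded o_def])
    from bilinear_eq_sum_Basis[OF this]
    have "m (B v) (B w) = (\<Sum>i\<in>Basis. \<Sum>j\<in>Basis. (v \<bullet> i) * (w \<bullet> j) * (if i = j then 1 else 0))"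
      using b by (simp add: Bb)
    also have "\<dots> = v \<bullet> w"
      by (simp add: euclidean_inner[of v w] if_distrib[where f="\<lambda>x. _ * x"] cong: if_cong)
    finally show ?thesis .
  qed
  have "norm (B v) \<le> norm v / sqrt l" for v
  proof -
    have "l * (norm (B v))\<^sup>2 \<le> (norm v)\<^sup>2"
      using l(2)[of "B v"] by (simp add: iso flip: dot_square_norm)
    then have "(sqrt l * norm (B v))\<^sup>2 \<le> (norm v)\<^sup>2" using l(1) by (simp add: power_mult_distrib)
    then have "sqrt l * norm (B v) \<le> norm v" by (rule power2_le_imp_le) simp
    then show ?thesis using l(1) by (simp add: pos_le_divide_eq mult.commute)
  qed
  with B iso show ?thesis by blast
qed

section \<open>Uniform lower bounds on metrics from compactness\<close>

lemma compact_pos_lower_bound: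
  fixes f :: "'a::topological_space \<Rightarrow> real"
  assumes "compact K" "continuous_on K f" "\<And>x. x \<in> K \<Longrightarrow> 0 < f x"
  shows "\<exists>l>0. \<forall>x\<in>K. l \<le> f x"
proof (cases "K = {}")
  case False
  from continuous_attains_inf[OF assms(1) this assms(2)] assms(3) show ?thesis by blast
qed (auto intro: zero_less_one)

lemma quadratic_form_lower_bound:
  fixes m :: "'a::euclidean_space \<Rightarrow> 'a \<Rightarrow> real"
  assumes "bilinear m" "\<And>u. norm u = 1 \<Longrightarrow> l \<le> m u u"
  shows "l * (v \<bullet> v) \<le> m v v"
proof (cases "v = 0")
  case True
  then show ?thesis using assms(1) by (simp add: bilinear_lzero)
next
  case False
  have "m v v = m (norm v *\<^sub>R sgn v) (norm v *\<^sub>R sgn v)" using False by (simp add: sgn_div_norm)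
  also have "\<dots> = (v \<bullet> v) * m (sgn v) (sgn v)"
    using assms(1) by (simp add: bilinear_lmul bilinear_rmul dot_square_norm power2_eq_square)
  finally show ?thesis
    using assms(2)[of "sgn v"] False by (simp add: norm_sgn mult.commute mult_left_mono)
qed

text \<open>With w = M v and s = w . M w, the form at v + t w equals 2 t |w|^2 + t^2 s. It is
  nonnegative for all t, so its linear coefficient must vanish.\<close>

lemma psd_matrix_kernel:
  fixes M :: "real ^ 'n ^ 'n"
  assumes "transpose M = M" "\<And>v. 0 \<le> v \<bullet> (M *v v)" "v \<bullet> (M *v v) = 0"
  shows "M *v v = 0"
proof -
  define w where "w = M *v v"
  define s where "s = w \<bullet> (M *v w)"
  have vw: "v \<bullet> (M *v w) = w \<bullet> w"
    unfolding w_def using assms(1) by (metis dot_lmul_matrix inner_commute transpose_matrix_vector)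
  have "0 \<le> 2 * t * (w \<bullet> w) + t\<^sup>2 * s" for t
  proof -
    have "(v + t *\<^sub>R w) \<bullet> (M *v (v + t *\<^sub>R w)) =
       v \<bullet> (M *v v) + t * (v \<bullet> (M *v w)) + t * (w \<bullet> (M *v v)) + t\<^sup>2 * s"
      by (simp add: matrix_vector_right_distrib matrix_vector_mult_scaleR inner_add_left inner_add_right
          s_def power2_eq_square algebra_simps)
    also have "\<dots> = 2 * t * (w \<bullet> w) + t\<^sup>2 * s"
      using assms(3) vw by (simp flip: w_def)
    finally show ?thesis using assms(2) by metis
  qed
  \<comment> \<open>The test value is t = - u. The minimiser itself would be - |w|^2 / s, but
    \<open>s\<close> may be 0; with s + 1 the value is still - (s + 2) u^2.\<close>
  define u where "u = (w \<bullet> w) / (s + 1)"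
  have s: "0 \<le> s" unfolding s_def by (rule assms(2))
  then have w: "w \<bullet> w = u * (s + 1)" by (simp add: u_def)
  have "0 \<le> 2 * (- u) * (w \<bullet> w) + (- u)\<^sup>2 * s" by fact
  also have "\<dots> = - ((s + 2) * u\<^sup>2)" unfolding w by (simp add: algebra_simps power2_eq_square)
  finally have "u\<^sup>2 \<le> 0" using s by (simp add: mult_le_0_iff)
  then have "w = 0" using w by simp
  then show ?thesis by (simp add: w_def)
qed

text \<open>Semidefiniteness is a closed condition and definiteness is not, so the compact set is
  cut out by the former together with the determinant bound. Definiteness returns because a null
  vector of a semidefinite form lies in the kernel. The bound \<open>l\<close> depends only on
  \<open>c\<close>, \<delta> and the dimension.\<close>

lemma det_lower_bound_imp_form_lower_bound:
  obtains l where "0 < l"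
    "\<And>(M :: real ^ 'n ^ 'n) v. (\<And>i j. \<bar>M $ i $ j\<bar> \<le> c) \<Longrightarrow> transpose M = M \<Longrightarrow>
      (\<And>v. 0 \<le> v \<bullet> (M *v v)) \<Longrightarrow> 0 < \<delta> \<Longrightarrow> \<delta> \<le> \<bar>det M\<bar> \<Longrightarrow> l * (v \<bullet> v) \<le> v \<bullet> (M *v v)"
proof (cases "0 < \<delta>")
  case False
  then show ?thesis using that[of 1] by auto
next
  case True
  define K where "K = {M :: real ^ 'n ^ 'n. (\<forall>i j. \<bar>M $ i $ j\<bar> \<le> c) \<and> transpose M = M \<and>
      (\<forall>v. 0 \<le> v \<bullet> (M *v v)) \<and> \<delta> \<le> \<bar>det M\<bar>}"
  have cont: "continuous_on UNIV (\<lambda>p :: (real ^ 'n ^ 'n) \<times> (real ^ 'n). snd p \<bullet> (fst p *v snd p))"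
    unfolding inner_vec_def matrix_vector_mult_def
    by (auto intro!: continuous_intros)
  have "closed K"
  proof -
    have "closed {M :: real ^ 'n ^ 'n. \<bar>M $ i $ j\<bar> \<le> c}" for i j
      by (intro closed_Collect_le continuous_intros)
    moreover have "closed {M :: real ^ 'n ^ 'n. transpose M = M}"
      unfolding transpose_def by (intro closed_Collect_eq continuous_intros)
    moreover have "closed {M :: real ^ 'n ^ 'n. 0 \<le> v \<bullet> (M *v v)}" for v
      unfolding inner_vec_def matrix_vector_mult_def
      by (intro closed_Collect_le) (auto intro!: continuous_intros)
    moreover have "closed {M :: real ^ 'n ^ 'n. \<delta> \<le> \<bar>det M\<bar>}"
      unfolding det_def by (intro closed_Collect_le continuous_intros)
    ultimately show ?thesis
      unfolding K_def by (intro closed_Collect_conj closed_Collect_all)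
  qed
  moreover have "bounded K"
  proof (rule boundedI)
    fix M assume M: "M \<in> K"
    have "norm M \<le> (\<Sum>i\<in>UNIV. norm (M $ i))" by (simp add: norm_vec_def L2_set_le_sum)
    also have "\<dots> \<le> (\<Sum>i\<in>(UNIV::'n set). \<Sum>j\<in>(UNIV::'n set). c)"
      by (intro sum_mono order_trans[OF norm_le_l1_cart]) (use M in \<open>auto simp: K_def\<close>)
    finally show "norm M \<le> (\<Sum>i\<in>(UNIV::'n set). \<Sum>j\<in>(UNIV::'n set). c)" .
  qed
  ultimately have "compact K" by (simp add: compact_eq_bounded_closed)
  then have "compact (K \<times> sphere (0 :: real ^ 'n) 1)" by (intro compact_Times) auto
  moreover have "0 < snd p \<bullet> (fst p *v snd p)" if p: "p \<in> K \<times> sphere (0 :: real ^ 'n) 1" for p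
  proof -
    obtain M v where Mv: "p = (M, v)" by fastforce
    have "v \<noteq> 0" and "det M \<noteq> 0" and M: "transpose M = M" "\<And>v. 0 \<le> v \<bullet> (M *v v)"
      using p True by (auto simp: Mv K_def)
    then have "M *v v \<noteq> 0"
      using invertible_det_nz matrix_left_invertible_ker invertible_def by metis
    then have "v \<bullet> (M *v v) \<noteq> 0" using psd_matrix_kernel[OF M] by blast
    then show ?thesis using M(2)[of v] by (simp add: Mv)
  qed
  ultimately have "\<exists>l>0. \<forall>p\<in>K \<times> sphere (0 :: real ^ 'n) 1. l \<le> snd p \<bullet> (fst p *v snd p)"
    by (intro compact_pos_lower_bound continuous_on_subset[OF cont subset_UNIV])
  then obtain l where l: "0 < l"
    "\<And>p. p \<in> K \<times> sphere (0 :: real ^ 'n) 1 \<Longrightarrow> l \<le> snd p \<bullet> (fst p *v snd p)"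
    by blast
  show ?thesis
  proof (rule that[OF l(1)])
    fix M :: "real ^ 'n ^ 'n" and v
    assume "\<And>i j. \<bar>M $ i $ j\<bar> \<le> c" "transpose M = M" "\<And>v. 0 \<le> v \<bullet> (M *v v)" "\<delta> \<le> \<bar>det M\<bar>"
    then have "M \<in> K" by (simp add: K_def)
    moreover have "bilinear (\<lambda>v w. v \<bullet> (M *v w))"
      by (auto simp: bilinear_def matrix_vector_right_distrib matrix_vector_mult_scaleR
          inner_add_left inner_add_right intro!: linearI)
    ultimately show "l * (v \<bullet> v) \<le> v \<bullet> (M *v v)"
      using l(2)[of "(M, _)"] by (intro quadratic_form_lower_bound[where m = "\<lambda>v w. v \<bullet> (M *v w)"]) auto
  qed
qed

text \<open>All that the later estimates know about a metric in a chart. The round metric and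
  \<open>g\<close> share one pair of constants, so that their convex combinations satisfy the same
  lower bound.\<close>

definition form_bounds :: "real \<Rightarrow> real \<Rightarrow> 'a::euclidean_space set \<Rightarrow> 'a tensor2 \<Rightarrow> bool" where
  "form_bounds K l U Q \<longleftrightarrow>
     (\<forall>i\<in>Basis. \<forall>j\<in>Basis. k_bounded_on 2 K U (\<lambda>x. Q x i j)) \<and>
     (\<forall>x\<in>U. bilinear (Q x) \<and> (\<forall>v w. Q x v w = Q x w v) \<and> (\<forall>v. l * (v \<bullet> v) \<le> Q x v v))"

lemma form_bounds_mono:
  assumes "form_bounds K l U Q" "K \<le> K'" "l' \<le> l"
  shows "form_bounds K' l' U Q"
proof -
  have "l' * (v \<bullet> v) \<le> l * (v \<bullet> v)" for v :: 'a using assms(3) by (intro mult_right_mono) auto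
  then show ?thesis
    using assms unfolding form_bounds_def by (meson k_bounded_on_mono order_trans subset_refl)
qed

text \<open>Tangency results from differentiating \<psi> y . \<psi> y = 1.\<close>

lemma sphere_chart_tangent:
  fixes \<psi> :: "'a::euclidean_space \<Rightarrow> 'b::euclidean_space"
  assumes "sphere_chart U \<psi>" "x \<in> U"
  shows "linear (frechet_derivative \<psi> (at x))" "\<psi> x \<in> sphere 0 1"
    "frechet_derivative \<psi> (at x) v \<in> sphere_tangent (\<psi> x)"
    "v \<noteq> 0 \<Longrightarrow> frechet_derivative \<psi> (at x) v \<noteq> 0"
proof -
  have U: "open U" "smooth_on U \<psi>" and inj: "inj (frechet_derivative \<psi> (at x))"
    using assms unfolding sphere_chart_def by auto
  have sph: "\<psi> y \<in> sphere 0 1" if "y \<in> U" for y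
    using assms(1) that openin_imp_subset unfolding sphere_chart_def by blast
  then show "\<psi> x \<in> sphere 0 1" using assms(2) by blast
  have D: "(\<psi> has_derivative frechet_derivative \<psi> (at x)) (at x)"
    by (rule smooth_on_has_derivative[OF U(2) assms(2)])
  then show lin: "linear (frechet_derivative \<psi> (at x))" by (rule has_derivative_linear)
  have "((\<lambda>y. \<psi> y \<bullet> \<psi> y) has_derivative
      (\<lambda>v. \<psi> x \<bullet> frechet_derivative \<psi> (at x) v + frechet_derivative \<psi> (at x) v \<bullet> \<psi> x)) (at x)"
    by (rule has_derivative_inner[OF D D])
  moreover have "((\<lambda>y. \<psi> y \<bullet> \<psi> y) has_derivative (\<lambda>v. 0)) (at x)"
    by (rule has_derivative_transform_within_open[OF has_derivative_const U(1) assms(2)])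
      (use sph in \<open>auto simp: dot_square_norm\<close>)
  ultimately have eq: "(\<lambda>v. \<psi> x \<bullet> frechet_derivative \<psi> (at x) v + frechet_derivative \<psi> (at x) v \<bullet> \<psi> x) = (\<lambda>v. 0)"
    by (rule has_derivative_unique)
  from fun_cong[OF eq, of v] show "frechet_derivative \<psi> (at x) v \<in> sphere_tangent (\<psi> x)"
    by (simp add: sphere_tangent_def inner_commute)
  show "frechet_derivative \<psi> (at x) v \<noteq> 0" if "v \<noteq> 0"
    using inj lin that by (metis injD linear_0)
qed

text \<open>Boundedness of \<open>g\<close> tells nothing about the round metric. Its bounds are
  attained on the compact closure of \<open>U\<close>, where the extension \<psi>' supplies
  smoothness and an injective derivative.\<close>

lemma pullback_round_form_bounds:
  fixes \<psi> :: "'a::euclidean_space \<Rightarrow> 'b::euclidean_space"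
  assumes "sphere_chart U \<psi>" "compact (closure U)" "closure U \<subseteq> V" "sphere_chart V \<psi>'"
    and eq: "\<And>x. x \<in> U \<Longrightarrow> \<psi>' x = \<psi> x"
  obtains K l where "0 < l" "form_bounds K l U (pullback \<psi> round_metric)"
proof -
  define Q where "Q = pullback \<psi>' (round_metric :: 'b tensor2)"
  have U: "open U" and V: "open V" "smooth_on V \<psi>'"
    using assms unfolding sphere_chart_def by auto
  have Qeq: "Q x = pullback \<psi> round_metric x" if "x \<in> U" for x
    using frechet_derivative_cong_open[OF U that eq] eq[OF that]
    by (simp add: Q_def pullback_def fun_eq_iff)
  have bil: "bilinear (Q x)" if "x \<in> V" for x
    using sphere_chart_tangent(1)[OF assms(4) that]
    by (auto simp: bilinear_def Q_def pullback_def round_metric_def linear_add linear_cmul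
        inner_add_left inner_add_right intro!: linearI)
  have sm: "smooth_on V (\<lambda>x. Q x i j)" if "i \<in> Basis" "j \<in> Basis" for i j
    unfolding Q_def pullback_def round_metric_def
    by (intro smooth_on_bilinear[OF bounded_bilinear_inner] V smooth_on_partial that)
  have "bounded (\<Union>(vs, i, j) \<in> {vs. set vs \<subseteq> Basis \<and> length vs \<le> 2} \<times> Basis \<times> Basis.
      iter_deriv vs (\<lambda>x. Q x i j) ` closure U)" (is "bounded (\<Union>p\<in>?I. ?F p)")
  proof (rule bounded_UN)
    show "finite ?I" by (intro finite_cartesian_product finite_lists_length_le) auto
    show "\<forall>p\<in>?I. bounded (?F p)"
      using assms(2,3) sm
      by (auto intro!: compact_imp_bounded compact_continuous_image
          continuous_on_subset[OF smooth_on_continuous] smooth_on_iter_deriv)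
  qed
  then obtain K where K: "\<And>vs i j x. set vs \<subseteq> Basis \<Longrightarrow> length vs \<le> 2 \<Longrightarrow> i \<in> Basis \<Longrightarrow>
     j \<in> Basis \<Longrightarrow> x \<in> closure U \<Longrightarrow> \<bar>iter_deriv vs (\<lambda>x. Q x i j) x\<bar> \<le> K"
    unfolding bounded_iff by fastforce
  have "compact (closure U \<times> sphere (0::'a) 1)" using assms(2) by (intro compact_Times) auto
  moreover have "continuous_on (closure U \<times> sphere (0::'a) 1) (\<lambda>p. Q (fst p) (snd p) (snd p))"
  proof -
    have "continuous_on (closure U \<times> sphere (0::'a) 1) (\<lambda>p. Q (fst p) i j)"
      if "i \<in> Basis" "j \<in> Basis" for i j
      using assms(3) by (intro continuous_on_compose2[OF smooth_on_continuous[OF sm[OF that]]])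
        (auto intro!: continuous_intros)
    then have "continuous_on (closure U \<times> sphere (0::'a) 1)
       (\<lambda>p. \<Sum>i\<in>Basis. \<Sum>j\<in>Basis. (snd p \<bullet> i) * (snd p \<bullet> j) * Q (fst p) i j)"
      by (intro continuous_intros)
    then show ?thesis
      by (rule continuous_on_eq) (use bilinear_eq_sum_Basis[OF bil] assms(3) in auto)
  qed
  moreover have "0 < Q (fst p) (snd p) (snd p)" if "p \<in> closure U \<times> sphere (0::'a) 1" for p
  proof -
    have "fst p \<in> V" "snd p \<noteq> 0" using that assms(3) by auto
    from sphere_chart_tangent(4)[OF assms(4) this] show ?thesis
      by (simp add: Q_def pullback_def round_metric_def)
  qed
  ultimately have "\<exists>l>0. \<forall>p\<in>closure U \<times> sphere (0::'a) 1. l \<le> Q (fst p) (snd p) (snd p)"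
    by (rule compact_pos_lower_bound)
  then obtain l where l: "0 < l" "\<And>p. p \<in> closure U \<times> sphere (0::'a) 1 \<Longrightarrow> l \<le> Q (fst p) (snd p) (snd p)"
    by blast
  have UV: "x \<in> V" "x \<in> closure U" if "x \<in> U" for x
    using that assms(3) closure_subset by auto
  have "form_bounds K l U (pullback \<psi> round_metric)"
    unfolding form_bounds_def
  proof (intro conjI ballI allI)
    fix i j :: 'a assume ij: "i \<in> Basis" "j \<in> Basis"
    have "k_bounded_on 2 K U (\<lambda>x. Q x i j)"
      using K UV ij by (intro smooth_on_k_bounded_on smooth_on_subset[OF sm]) auto
    then show "k_bounded_on 2 K U (\<lambda>x. pullback \<psi> round_metric x i j)"
      by (rule k_bounded_on_cong[OF U, rotated]) (simp add: Qeq)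
  next
    fix x assume x: "x \<in> U"
    have "bilinear (Q x)" using bil UV x by blast
    then show "bilinear (pullback \<psi> round_metric x)" by (simp add: Qeq x)
    show "l * (v \<bullet> v) \<le> pullback \<psi> round_metric x v v" for v
      using l(2)[of "(x, _)"] UV(2)[OF x] \<open>bilinear (Q x)\<close>
      unfolding Qeq[OF x, symmetric] by (intro quadratic_form_lower_bound) auto
    show "pullback \<psi> round_metric x v w = pullback \<psi> round_metric x w v" for v w
      by (simp add: pullback_def round_metric_def inner_commute)
  qed
  with l(1) show ?thesis by (rule that)
qed

lemma admissible_atlas_round_form_bounds:
  assumes "admissible_atlas \<A>"
  shows "\<exists>K l. 0 < l \<and> (\<forall>(U, \<psi>) \<in> \<A>. form_bounds K l U (pullback \<psi> round_metric))"
proof -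
  have each: "\<exists>K l. 0 < l \<and> form_bounds K l U (pullback \<psi> round_metric)" if "(U, \<psi>) \<in> \<A>" for U \<psi>
  proof -
    have "sphere_chart U \<psi>" "compact (closure U)"
      "\<exists>V \<psi>'. closure U \<subseteq> V \<and> sphere_chart V \<psi>' \<and> (\<forall>x\<in>U. \<psi>' x = \<psi> x)"
      using assms that unfolding admissible_atlas_def by auto
    then show ?thesis by (metis pullback_round_form_bounds)
  qed
  have "finite \<A>" using assms unfolding admissible_atlas_def by auto
  then show ?thesis
    using each
  proof (induction \<A>)
    case empty
    then show ?case using zero_less_one by blast
  next
    case (insert p \<A>)
    obtain U \<psi> where p: "p = (U, \<psi>)" by fastforce
    obtain K l where 1: "0 < l" "\<forall>(U, \<psi>) \<in> \<A>. form_bounds K l U (pullback \<psi> round_metric)"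
      using insert by blast
    obtain K' l' where 2: "0 < l'" "form_bounds K' l' U (pullback \<psi> round_metric)"
      using insert.prems p by blast
    have "\<forall>(U, \<psi>) \<in> insert p \<A>. form_bounds (max K K') (min l l') U (pullback \<psi> round_metric)"
      using 1(2) 2(2) p by (auto intro: form_bounds_mono)
    then show ?case using 1(1) 2(1) by (metis min_less_iff_conj)
  qed
qed

text \<open>\<open>g\<close> is constrained only on tangent vectors of the sphere, so bilinearity
  becomes available after pulling back. Linearity in the second argument is obtained from the first
  by symmetry.\<close>

lemma pullback_riemannian_form:
  fixes \<psi> :: "'a::euclidean_space \<Rightarrow> 'b::euclidean_space"
  assumes "riemannian_sphere TYPE('a) g" "sphere_chart U \<psi>" "x \<in> U"
  shows "bilinear (pullback \<psi> g x)" "pullback \<psi> g x v w = pullback \<psi> g x w v"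
    "v \<noteq> 0 \<Longrightarrow> 0 < pullback \<psi> g x v v"
proof -
  note T = sphere_chart_tangent[OF assms(2,3)]
  have g: "\<And>u v w \<alpha> \<beta>. u \<in> sphere_tangent (\<psi> x) \<Longrightarrow> v \<in> sphere_tangent (\<psi> x) \<Longrightarrow> w \<in> sphere_tangent (\<psi> x) \<Longrightarrow>
      g (\<psi> x) (\<alpha> *\<^sub>R u + \<beta> *\<^sub>R v) w = \<alpha> * g (\<psi> x) u w + \<beta> * g (\<psi> x) v w"
    "\<And>v w. v \<in> sphere_tangent (\<psi> x) \<Longrightarrow> w \<in> sphere_tangent (\<psi> x) \<Longrightarrow> g (\<psi> x) v w = g (\<psi> x) w v"
    "\<And>v. v \<in> sphere_tangent (\<psi> x) \<Longrightarrow> v \<noteq> 0 \<Longrightarrow> 0 < g (\<psi> x) v v"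
    using assms(1) T(2) unfolding riemannian_sphere_def by blast+
  show sym: "pullback \<psi> g x v w = pullback \<psi> g x w v" for v w
    unfolding pullback_def by (intro g T)
  have "linear (\<lambda>v. pullback \<psi> g x v w)" for w
  proof (rule linearI)
    show "pullback \<psi> g x (u + v) w = pullback \<psi> g x u w + pullback \<psi> g x v w" for u v
      unfolding pullback_def linear_add[OF T(1)] using g(1)[OF T(3) T(3) T(3), of 1 _ 1] by simp
    show "pullback \<psi> g x (r *\<^sub>R v) w = r *\<^sub>R pullback \<psi> g x v w" for r v
      unfolding pullback_def linear_cmul[OF T(1)] using g(1)[OF T(3) T(3) T(3), of r _ 0] by simp
  qed
  moreover from this have "linear (pullback \<psi> g x v)" for v
    by (rule back_subst[where P = linear]) (rule ext, rule sym)
  ultimately show "bilinear (pullback \<psi> g x)"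
    unfolding bilinear_def by blast
  show "0 < pullback \<psi> g x v v" if "v \<noteq> 0"
    unfolding pullback_def by (intro g T that)
qed

text \<open>The order of quantifiers matters: \<open>l\<close> results from the compactness argument
  with entries bounded by \<open>c\<close> and determinant at least 1/c, and is fixed before atlas,
  metric and chart.\<close>

lemma c_bounded_form_bounds:
  assumes "0 < c"
  shows "\<exists>l>0. \<forall>\<A> (g :: 'b::euclidean_space tensor2) U (\<psi> :: real ^ 'n \<Rightarrow> 'b).
    admissible_atlas \<A> \<longrightarrow> riemannian_sphere TYPE(real ^ 'n) g \<longrightarrow> c_bounded \<A> c g \<longrightarrow>
    (U, \<psi>) \<in> \<A> \<longrightarrow> form_bounds c l U (pullback \<psi> g)"
proof -
  obtain l where l: "0 < l"
    "\<And>(M :: real ^ 'n ^ 'n) v. (\<And>i j. \<bar>M $ i $ j\<bar> \<le> c) \<Longrightarrow> transpose M = M \<Longrightarrow>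
      (\<And>v. 0 \<le> v \<bullet> (M *v v)) \<Longrightarrow> 0 < 1 / c \<Longrightarrow> 1 / c \<le> \<bar>det M\<bar> \<Longrightarrow> l * (v \<bullet> v) \<le> v \<bullet> (M *v v)"
    using det_lower_bound_imp_form_lower_bound by blast
  show ?thesis
  proof (intro exI[of _ l] conjI allI impI, rule l(1))
    fix \<A> and g :: "'b tensor2" and U and \<psi> :: "real ^ 'n \<Rightarrow> 'b"
    assume A: "admissible_atlas \<A>" and g: "riemannian_sphere TYPE(real ^ 'n) g"
      and cb: "c_bounded \<A> c g" and U: "(U, \<psi>) \<in> \<A>"
    have ch: "sphere_chart U \<psi>" using A U unfolding admissible_atlas_def by auto
    note Q = pullback_riemannian_form[OF g ch]
    have sm: "smooth_on U (\<lambda>x. pullback \<psi> g x i j)" if "i \<in> Basis" "j \<in> Basis" for i j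
      using g ch that unfolding riemannian_sphere_def by blast
    have bd: "k_bounded_on 2 c U (\<lambda>x. pullback \<psi> g x i j)" if "i \<in> Basis" "j \<in> Basis" for i j
      using cb U that by (intro k_bounded_on_C2_norm sm) (auto simp: c_bounded_def)
    have "l * (v \<bullet> v) \<le> pullback \<psi> g x v v" if x: "x \<in> U" for x v
    proof -
      define M where "M = chart_matrix \<psi> g x"
      have Mv: "v \<bullet> (M *v v) = pullback \<psi> g x v v" for v
      proof -
        have *: "(\<Sum>i\<in>Basis. f i) = (\<Sum>i\<in>UNIV. f (axis i 1))" for f :: "real ^ 'n \<Rightarrow> real"
        proof -
          have "(Basis :: (real ^ 'n) set) = range (\<lambda>i. axis i 1)" by (auto simp: Basis_vec_def)
          then show ?thesis
            by (intro sum.reindex_cong[where l = "\<lambda>i. axis i 1"]) (auto simp: inj_on_def axis_eq_axis)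
        qed
        have "v \<bullet> (M *v v) = (\<Sum>i\<in>UNIV. \<Sum>j\<in>UNIV. v $ i * (v $ j * pullback \<psi> g x (axis i 1) (axis j 1)))"
          by (simp add: inner_vec_def matrix_vector_mult_def M_def chart_matrix_def
              sum_distrib_left mult_ac)
        then show ?thesis
          unfolding bilinear_eq_sum_Basis[OF Q(1)[OF x], of v v]
          by (simp add: * inner_axis mult_ac)
      qed
      have "\<bar>M $ i $ j\<bar> \<le> c" for i j
        using k_bounded_on_bound[OF bd x, of "axis i 1" "axis j 1"]
        by (simp add: M_def chart_matrix_def axis_in_Basis_iff)
      moreover have "transpose M = M"
        unfolding transpose_def M_def chart_matrix_def vec_eq_iff vec_lambda_beta
        by (intro allI) (rule Q(2)[OF x])
      moreover have "0 \<le> v \<bullet> (M *v v)" for v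
        using Q(3)[OF x, of v] Q(1)[OF x] unfolding Mv
        by (cases "v = 0") (auto simp: bilinear_lzero)
      moreover have "1 / c \<le> \<bar>det M\<bar>"
        using cb U x unfolding c_bounded_def M_def by fastforce
      ultimately show ?thesis using l(2)[of M v] assms Mv by simp
    qed
    moreover have "\<forall>v w. pullback \<psi> g x v w = pullback \<psi> g x w v" if "x \<in> U" for x
      by (intro allI) (rule Q(2)[OF that])
    ultimately show "form_bounds c l U (pullback \<psi> g)"
      unfolding form_bounds_def using bd Q(1) by (intro conjI ballI) blast+
  qed
qed

section \<open>Estimates on the model domain\<close>


text \<open>An injective linear map of a Euclidean space to itself is onto and hence open, so the
  new chart still has an image that is open in the sphere.\<close>

lemma sphere_chart_compose_affine:
  fixes \<psi> :: "'a::euclidean_space \<Rightarrow> 'b::euclidean_space" and l :: "'a \<Rightarrow> 'a"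
  assumes \<psi>: "sphere_chart U \<psi>" and l: "linear l" "inj l"
    and V: "open V" "\<And>x. x \<in> V \<Longrightarrow> c + l x \<in> U"
  shows "sphere_chart V (\<lambda>x. \<psi> (c + l x))"
    and "x \<in> V \<Longrightarrow> frechet_derivative (\<lambda>x. \<psi> (c + l x)) (at x) v = frechet_derivative \<psi> (at (c + l x)) (l v)"
proof -
  define L where "L x = c + l x" for x
  have U: "open U" "smooth_on U \<psi>" and op: "openin (top_of_set (sphere 0 1)) (\<psi> ` U)"
    and inj\<psi>: "\<And>x. x \<in> U \<Longrightarrow> inj (frechet_derivative \<psi> (at x))"
    using \<psi> unfolding sphere_chart_def by auto
  obtain \<theta> where \<theta>: "homeomorphism U (\<psi> ` U) \<psi> \<theta>" using \<psi> unfolding sphere_chart_def by blast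
  have LV: "L ` V \<subseteq> U" using V(2) by (auto simp: L_def)
  have injL: "inj L" using l(2) by (simp add: L_def inj_on_def)
  have "open (L ` V)"
    unfolding L_def using open_translation[OF open_surjective_linear_image[OF V(1) l(1) linear_inj_imp_surj[OF l]], of c]
    by (simp add: image_image)
  have der: "((\<lambda>x. \<psi> (L x)) has_derivative (\<lambda>v. frechet_derivative \<psi> (at (L x)) (l v))) (at x)"
    if "x \<in> V" for x
  proof (rule has_derivative_compose[where g = \<psi>])
    show "(L has_derivative l) (at x)"
      unfolding L_def using l(1) by (auto intro!: derivative_eq_intros linear_imp_has_derivative)
    show "(\<psi> has_derivative frechet_derivative \<psi> (at (L x))) (at (L x))"
      by (rule smooth_on_has_derivative[OF U(2)]) (use LV that in blast)
  qed
  then have fd: "frechet_derivative (\<lambda>x. \<psi> (L x)) (at x) = (\<lambda>v. frechet_derivative \<psi> (at (L x)) (l v))"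
    if "x \<in> V" for x
    using that frechet_derivative_at[symmetric] by blast
  then show "x \<in> V \<Longrightarrow> frechet_derivative (\<lambda>x. \<psi> (c + l x)) (at x) v = frechet_derivative \<psi> (at (c + l x)) (l v)"
    by (simp add: L_def)
  have hom: "homeomorphism (L ` V) (\<psi> ` L ` V) \<psi> \<theta>"
    using homeomorphism_of_subsets[OF \<theta> LV] by blast
  have "openin (top_of_set (\<psi> ` U)) (\<psi> ` L ` V)"
  proof (rule homeomorphism_imp_open_map[OF \<theta>])
    show "openin (top_of_set U) (L ` V)"
      using \<open>open (L ` V)\<close> LV unfolding openin_open by blast
  qed
  then have op': "openin (top_of_set (sphere 0 1)) (\<psi> ` L ` V)"
    using op openin_trans by blast
  obtain l' where l'0: "linear l'" "l' \<circ> l = id"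
    using linear_injective_left_inverse[OF l] by blast
  have l'l: "l' (l x) = x" for x using fun_cong[OF l'0(2), of x] by simp
  have "homeomorphism V (L ` V) L (\<lambda>y. l' (y - c))"
  proof (rule homeomorphismI)
    show "continuous_on V L"
      unfolding L_def using l(1)
      by (intro continuous_on_add continuous_on_const linear_continuous_on)
        (simp add: linear_conv_bounded_linear)
    have "continuous_on UNIV l'"
      using l'0(1) by (intro linear_continuous_on) (simp add: linear_conv_bounded_linear)
    then show "continuous_on (L ` V) (\<lambda>y. l' (y - c))"
      by (rule continuous_on_compose2) (auto intro!: continuous_intros)
  qed (auto simp: L_def l'l)
  from homeomorphism_compose[OF this hom]
  have hom': "\<exists>\<theta>. homeomorphism V ((\<lambda>x. \<psi> (L x)) ` V) (\<lambda>x. \<psi> (L x)) \<theta>"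
    by (auto simp: o_def image_image)
  have "smooth_on V (\<lambda>x. \<psi> (L x))"
    unfolding L_def
    by (rule smooth_on_compose[where f = "\<lambda>x. c + l x" and h = \<psi> and V = U,
          OF V(1) _ smooth_on_affine[OF l(1) V(1)] U(2)]) (use V(2) in auto)
  moreover have "inj (frechet_derivative (\<lambda>x. \<psi> (L x)) (at x))" if "x \<in> V" for x
    unfolding fd[OF that] using inj_compose[OF inj\<psi> l(2), of "L x"] LV that by (auto simp: o_def)
  ultimately have "sphere_chart V (\<lambda>x. \<psi> (L x))"
    using V(1) op' hom' unfolding sphere_chart_def by (simp add: image_image)
  then show "sphere_chart V (\<lambda>x. \<psi> (c + l x))" by (simp add: L_def)
qed

section \<open>The model domain and functions of time on it\<close>

lemma open_model_domain: "open (model_domain \<xi>)"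
  by (simp add: model_domain_def open_Times)

lemma convex_model_domain: "convex (model_domain \<xi>)"
  by (simp add: model_domain_def convex_Times)

lemma norm_model_domain:
  assumes "z \<in> model_domain \<xi>"
  shows "norm z \<le> 2 + \<xi>"
proof -
  have "norm z \<le> norm (fst z) + norm (snd z)" by (metis norm_Pair_le prod.collapse)
  also have "\<dots> \<le> 2 + \<xi>" using assms by (auto simp: model_domain_def)
  finally show ?thesis .
qed

lemma k_bounded_on_snd:
  fixes f :: "real \<Rightarrow> real"
  assumes "k_bounded_on n K {- (1 + \<xi>)<..<1 + \<xi>} f" "0 \<le> K"
  shows "k_bounded_on n K (model_domain \<xi> :: ('a::euclidean_space \<times> real) set) (\<lambda>z. f (snd z))"
proof -
  have "k_bounded_on n K (model_domain \<xi> :: ('a \<times> real) set) (\<lambda>z. f (0 + snd z))"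
    by (rule k_bounded_on_compose_affine'[OF _ _ open_model_domain _ assms])
      (auto simp: linear_snd Basis_prod_def model_domain_def)
  then show ?thesis by simp
qed

lemma k_bounded_on_exp_snd:
  assumes "\<bar>\<alpha>\<bar> \<le> 2"
  shows "k_bounded_on 2 (4 * exp (2 * (1 + \<xi>))) (model_domain \<xi> :: ('a::euclidean_space \<times> real) set)
    (\<lambda>z. exp (\<alpha> * snd z))"
  using k_bounded_on_snd[OF k_bounded_on_exp[OF assms, of 2 "1 + \<xi>"]] by simp

text \<open>
  The coefficient of the deformed metric in a frame \<open>B\<close> scaled by \<open>\<mu>\<close>, as a function on the model
  domain: \<open>S\<close> and \<open>W\<close> are the round metric and \<open>g\<close> in a chart, \<open>s\<close> is the time shift.
\<close>

definition frame_coeff ::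
  "(real \<Rightarrow> real) \<Rightarrow> real \<Rightarrow> real \<Rightarrow> 'a::euclidean_space tensor2 \<Rightarrow> 'a tensor2 \<Rightarrow> real \<Rightarrow> 'a \<Rightarrow>
    real \<Rightarrow> ('a \<Rightarrow> 'a) \<Rightarrow> 'a \<Rightarrow> 'a \<Rightarrow> 'a \<times> real \<Rightarrow> real" where
  "frame_coeff \<rho> a d S W s c \<mu> B v w z =
     S (c + \<mu> *\<^sub>R B (fst z)) (B v) (B w) + \<rho> (2 * ((snd z + s - a) / d)) *
       (W (c + \<mu> *\<^sub>R B (fst z)) (B v) (B w) - S (c + \<mu> *\<^sub>R B (fst z)) (B v) (B w))"

text \<open>Expanding both frame vectors in the basis gives DIM^2 terms, each with a coefficient of
  size at most \<beta>^2.\<close>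

lemma k_bounded_on_form_frame:
  fixes Q :: "'a::euclidean_space tensor2" and K \<beta> :: real and B :: "'a \<Rightarrow> 'a"
  assumes "form_bounds K l U Q" "open U" "0 \<le> K"
    and "\<And>v. norm (B v) \<le> \<beta> * norm v" "v \<in> Basis" "w \<in> Basis"
  shows "k_bounded_on 2 ((DIM('a) * \<beta>)\<^sup>2 * K) U (\<lambda>x. Q x (B v) (B w))"
proof -
  have comp: "\<bar>B u \<bullet> i\<bar> \<le> \<beta>" if "u \<in> Basis" "i \<in> Basis" for u i
    using Basis_le_norm[OF that(2), of "B u"] assms(4)[of u] that(1) by simp
  have b0: "0 \<le> \<beta>" using comp[OF assms(5,5)] by linarith
  have bd: "k_bounded_on 2 (\<Sum>i\<in>Basis. \<Sum>j\<in>Basis. \<bar>(B v \<bullet> i) * (B w \<bullet> j)\<bar> * K) U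
     (\<lambda>x. \<Sum>i\<in>Basis. \<Sum>j\<in>Basis. ((B v \<bullet> i) * (B w \<bullet> j)) * Q x i j)"
    using assms(1) unfolding form_bounds_def
    by (intro k_bounded_on_sum k_bounded_on_cmult assms(2) finite_Basis) auto
  have "(\<Sum>i\<in>Basis. \<Sum>j\<in>Basis. \<bar>(B v \<bullet> i) * (B w \<bullet> j)\<bar> * K) \<le>
      (\<Sum>i\<in>(Basis::'a set). \<Sum>j\<in>(Basis::'a set). \<beta> * \<beta> * K)"
    using comp assms(3,5,6) b0 by (intro sum_mono mult_right_mono) (auto simp: abs_mult intro!: mult_mono)
  also have "\<dots> = (DIM('a) * \<beta>)\<^sup>2 * K" by (simp add: power2_eq_square mult_ac)
  finally show ?thesis
    by (intro k_bounded_on_cong[OF assms(2) _ k_bounded_on_mono[OF bd subset_refl]])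
      (use assms(1) in \<open>auto simp: form_bounds_def intro!: bilinear_eq_sum_Basis[symmetric]\<close>)
qed

lemma scaled_frame_row_sum:
  fixes B :: "'a::euclidean_space \<Rightarrow> 'a" and \<beta> \<mu> :: real
  assumes "\<And>v. norm (B v) \<le> \<beta> * norm v" "0 \<le> \<beta>" "0 \<le> \<mu>" "v \<in> (Basis :: ('a \<times> real) set)"
  shows "(\<Sum>e\<in>Basis. \<bar>(\<mu> *\<^sub>R B (fst v)) \<bullet> e\<bar>) \<le> DIM('a) * \<beta> * \<mu>"
proof -
  have "norm (fst v) \<le> 1" using assms(4) by (auto simp: Basis_prod_def)
  then have "\<beta> * norm (fst v) \<le> \<beta>" using assms(2) mult_left_mono[of "norm (fst v)" 1 \<beta>] by simp
  then have "norm (B (fst v)) \<le> \<beta>" using assms(1)[of "fst v"] by linarith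
  then have "\<bar>(\<mu> *\<^sub>R B (fst v)) \<bullet> e\<bar> \<le> \<mu> * \<beta>" if "e \<in> Basis" for e
    using Basis_le_norm[OF that, of "B (fst v)"] assms(3)
    by (simp add: abs_mult) (meson mult_left_mono order_trans)
  then have "(\<Sum>e\<in>Basis. \<bar>(\<mu> *\<^sub>R B (fst v)) \<bullet> e\<bar>) \<le> (\<Sum>e\<in>(Basis::'a set). \<mu> * \<beta>)"
    by (rule sum_mono)
  then show ?thesis by (simp add: mult_ac)
qed

text \<open>Serves both cases of the main estimate: an isometric frame at scale 2 e^(-s), and the
  identity frame at a tiny scale. The condition DIM \<beta> \<mu> <= 1 does two things: it keeps the
  chart within the unit ball around \<open>c\<close>, and it ensures that composing with the scaled
  frame does not enlarge derivative bounds.\<close>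

locale scaled_frame =
  fixes \<rho> :: "real \<Rightarrow> real" and K \<beta> \<mu> \<xi> d a s l :: real and U :: "'a::euclidean_space set"
    and S W :: "'a tensor2" and c :: 'a and B :: "'a \<Rightarrow> 'a"
  assumes \<rho>: "warping_cutoff \<rho>"
    and S: "form_bounds K l U S" and W: "form_bounds K l U W"
    and U: "open U" "ball c 1 \<subseteq> U"
    and B: "linear B" "\<And>v. norm (B v) \<le> \<beta> * norm v"
    and nn: "0 \<le> K" "0 \<le> \<beta>" "0 < \<mu>" "DIM('a) * \<beta> * \<mu> \<le> 1" "0 < d" "0 \<le> \<xi>"
begin

definition H where "H = (DIM('a) * \<beta>)\<^sup>2 * K"

lemma H_nonneg: "0 \<le> H" using nn by (simp add: H_def)

lemma chart_point_in:
  assumes "norm x < 1"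
  shows "c + \<mu> *\<^sub>R B x \<in> U"
proof -
  have "1 * (\<beta> * \<mu>) \<le> DIM('a) * (\<beta> * \<mu>)"
  proof (rule mult_right_mono)
    show "1 \<le> real DIM('a)" using DIM_positive[where 'a='a] by linarith
  qed (use nn in simp)
  then have bm: "\<beta> * \<mu> \<le> 1" using nn(4) by (simp add: mult.assoc)
  have "norm (\<mu> *\<^sub>R B x) \<le> \<mu> * (\<beta> * norm x)" using B(2)[of x] nn by simp
  also have "\<dots> = (\<beta> * \<mu>) * norm x" by simp
  also have "\<dots> \<le> 1 * norm x" by (rule mult_right_mono[OF bm]) simp
  also have "\<dots> < 1" using assms by simp
  finally have "c + \<mu> *\<^sub>R B x \<in> ball c 1" by (simp add: dist_norm)
  then show ?thesis using U(2) by blast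
qed

lemma linear_frame: "linear (\<lambda>z :: 'a \<times> real. \<mu> *\<^sub>R B (fst z))"
  by (intro linear_compose_scale_right linear_compose[OF linear_fst B(1), unfolded o_def])

lemma row_sum: "v \<in> Basis \<Longrightarrow> (\<Sum>e\<in>Basis. \<bar>(\<mu> *\<^sub>R B (fst (v :: 'a \<times> real))) \<bullet> e\<bar>) \<le> DIM('a) * \<beta> * \<mu>"
  by (rule scaled_frame_row_sum) (use B nn in auto)

lemma mapsto: "z \<in> model_domain \<xi> \<Longrightarrow> c + \<mu> *\<^sub>R B (fst z) \<in> U"
  by (rule chart_point_in) (auto simp: model_domain_def)

lemma zero_mem: "0 \<in> (model_domain \<xi> :: ('a \<times> real) set)"
  using nn by (simp add: model_domain_def zero_prod_def)

lemma coeff_bound: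
  assumes "form_bounds K l U Q" "v \<in> Basis" "w \<in> Basis"
  shows "k_bounded_on 2 H (model_domain \<xi>) (\<lambda>z. Q (c + \<mu> *\<^sub>R B (fst z)) (B v) (B w))"
  using k_bounded_on_compose_affine'[OF linear_frame order_trans[OF row_sum nn(4)] open_model_domain
      mapsto k_bounded_on_form_frame[OF assms(1) U(1) nn(1) B(2) assms(2,3)]] H_nonneg
  by (simp add: H_def)

text \<open>The factor from \<open>k_bounded_on_affine_increment\<close> on the model domain, which
  has dimension DIM + 1 and lies within distance 2 + \<xi> of the origin.\<close>

definition E where "E = 1 + (DIM('a) + 1) * (2 + \<xi>)"

lemma E_nonneg: "0 \<le> E" using nn by (simp add: E_def)

lemma coeff_increment_bound:
  assumes "form_bounds K l U Q" "v \<in> Basis" "w \<in> Basis"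
  shows "k_bounded_on 2 (DIM('a) * \<beta> * \<mu> * H * E) (model_domain \<xi>)
    (\<lambda>z. Q (c + \<mu> *\<^sub>R B (fst z)) (B v) (B w) - Q c (B v) (B w))"
proof -
  have "k_bounded_on (Suc 1) H U (\<lambda>x. Q x (B v) (B w))"
    using k_bounded_on_form_frame[OF assms(1) U(1) nn(1) B(2) assms(2,3)]
    by (simp add: H_def numeral_2_eq_2)
  from k_bounded_on_affine_increment[OF linear_frame row_sum _ nn(4) open_model_domain
      convex_model_domain zero_mem norm_model_domain mapsto this H_nonneg] nn
  show ?thesis by (simp add: E_def numeral_2_eq_2 add.commute)
qed

text \<open>Affine in the time with slope 2/d; this slope is the origin of the term 1/d in the final
  estimate.\<close>

lemma cutoff_arg: "2 * ((t + s - a) / d) = 2 * (s - a) / d + 2 / d * t"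
  by (simp add: field_simps add_divide_distrib diff_divide_distrib)

text \<open>Valid for every \<open>d\<close>, but uniform only while 2/d <= 1: the square accounts
  for the second derivatives.\<close>

lemma cutoff_bound:
  "k_bounded_on 2 (max 1 (2 / d) ^ 2 * 12) (model_domain \<xi> :: ('a \<times> real) set)
     (\<lambda>z. \<rho> (2 * ((snd z + s - a) / d)))"
  unfolding cutoff_arg
proof (rule k_bounded_on_compose_affine[OF _ _ open_model_domain _ warping_cutoff_k_bounded_on[OF \<rho>]])
  show "linear (\<lambda>z :: 'a \<times> real. 2 / d * snd z)"
    by (rule linearI) (simp_all add: algebra_simps add_divide_distrib)
qed (use nn in \<open>auto simp: Basis_prod_def\<close>)

lemma cutoff_increment_bound:
  assumes "2 / d \<le> 1"
  shows "k_bounded_on 2 (2 / d * 12 * E) (model_domain \<xi> :: ('a \<times> real) set)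
     (\<lambda>z. \<rho> (2 * ((snd z + s - a) / d)) - \<rho> (2 * ((s - a) / d)))"
proof -
  have "k_bounded_on (Suc 1) (2 / d * 12 * (1 + DIM('a \<times> real) * (2 + \<xi>))) (model_domain \<xi> :: ('a \<times> real) set)
     (\<lambda>z. \<rho> (2 * (s - a) / d + 2 / d * snd z) - \<rho> (2 * (s - a) / d))"
  proof (rule k_bounded_on_affine_increment[OF _ _ _ assms open_model_domain
      convex_model_domain zero_mem norm_model_domain])
    show "linear (\<lambda>z :: 'a \<times> real. 2 / d * snd z)"
      by (rule linearI) (simp_all add: algebra_simps add_divide_distrib)
    show "k_bounded_on (Suc 1) 12 UNIV \<rho>"
      using warping_cutoff_k_bounded_on[OF \<rho>] by (simp add: numeral_2_eq_2)
  qed (use nn in \<open>auto simp: Basis_prod_def\<close>)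
  then show ?thesis
    unfolding cutoff_arg by (simp add: E_def numeral_2_eq_2 add.commute)
qed

lemma frame_coeff_bound:
  assumes "v \<in> Basis" "w \<in> Basis"
  shows "k_bounded_on 2 (H + 2\<^sup>2 * (max 1 (2 / d) ^ 2 * 12 * (H + H))) (model_domain \<xi>)
    (frame_coeff \<rho> a d S W s c \<mu> B v w)"
  unfolding frame_coeff_def[abs_def]
  by (intro k_bounded_on_add k_bounded_on_mult k_bounded_on_diff open_model_domain coeff_bound
      cutoff_bound assms S W)

text \<open>Telescoping: the increment of S + \<rho> (W - S) is the increment of S, plus that of
  \<rho> times W - S, plus the central value of \<rho> times the increment of W - S. The first and
  third parts contribute three times the spatial oscillation, the second contributes 192 H E /
  d.\<close>

lemma frame_coeff_increment_bound:
  assumes "v \<in> Basis" "w \<in> Basis" "2 / d \<le> 1"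
  shows "k_bounded_on 2 (3 * (DIM('a) * \<beta> * \<mu> * H * E) + 192 * H * E / d) (model_domain \<xi>)
    (\<lambda>z. frame_coeff \<rho> a d S W s c \<mu> B v w z - frame_coeff \<rho> a d S W s c \<mu> B v w 0)"
proof -
  define r0 where "r0 = \<rho> (2 * ((s - a) / d))"
  define M where "M = DIM('a) * \<beta> * \<mu> * H * E"
  have r0: "\<bar>r0\<bar> \<le> 1" using \<rho> by (auto simp: r0_def warping_cutoff_def)
  have M: "0 \<le> M" using H_nonneg E_nonneg nn by (simp add: M_def)
  have "k_bounded_on 2 (M + 2\<^sup>2 * ((2 / d * 12 * E) * (H + H)) + \<bar>r0\<bar> * (M + M)) (model_domain \<xi>)
    (\<lambda>z. (S (c + \<mu> *\<^sub>R B (fst z)) (B v) (B w) - S c (B v) (B w)) +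
      (\<rho> (2 * ((snd z + s - a) / d)) - \<rho> (2 * ((s - a) / d))) *
        (W (c + \<mu> *\<^sub>R B (fst z)) (B v) (B w) - S (c + \<mu> *\<^sub>R B (fst z)) (B v) (B w)) +
      r0 * ((W (c + \<mu> *\<^sub>R B (fst z)) (B v) (B w) - W c (B v) (B w)) -
        (S (c + \<mu> *\<^sub>R B (fst z)) (B v) (B w) - S c (B v) (B w))))"
    unfolding M_def
    by (intro k_bounded_on_add k_bounded_on_mult k_bounded_on_cmult k_bounded_on_diff
        open_model_domain coeff_increment_bound coeff_bound cutoff_increment_bound assms S W)
  moreover have "M + 2\<^sup>2 * ((2 / d * 12 * E) * (H + H)) + \<bar>r0\<bar> * (M + M) \<le>
      3 * (DIM('a) * \<beta> * \<mu> * H * E) + 192 * H * E / d"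
  proof -
    have "\<bar>r0\<bar> * (M + M) \<le> 1 * (M + M)" by (intro mult_right_mono r0) (use M in auto)
    moreover have eq: "2\<^sup>2 * ((2 / d * 12 * E) * (H + H)) = 192 * H * E / d" by simp
    ultimately show ?thesis unfolding M_def[symmetric] eq by simp
  qed
  ultimately have "k_bounded_on 2 (3 * (DIM('a) * \<beta> * \<mu> * H * E) + 192 * H * E / d) (model_domain \<xi>)
    (\<lambda>z. (S (c + \<mu> *\<^sub>R B (fst z)) (B v) (B w) - S c (B v) (B w)) +
      (\<rho> (2 * ((snd z + s - a) / d)) - \<rho> (2 * ((s - a) / d))) *
        (W (c + \<mu> *\<^sub>R B (fst z)) (B v) (B w) - S (c + \<mu> *\<^sub>R B (fst z)) (B v) (B w)) +
      r0 * ((W (c + \<mu> *\<^sub>R B (fst z)) (B v) (B w) - W c (B v) (B w)) -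
        (S (c + \<mu> *\<^sub>R B (fst z)) (B v) (B w) - S c (B v) (B w))))"
    by (rule k_bounded_on_mono[OF _ subset_refl])
  then show ?thesis
    by (rule k_bounded_on_cong[OF open_model_domain, rotated])
      (simp add: frame_coeff_def linear_0[OF B(1)] r0_def algebra_simps)
qed

lemma warping_factor: "(2 * exp (- s))\<^sup>2 * (sinh (t + s))\<^sup>2 =
   exp (2 * t) + (- (2 * exp (- 2 * s)) + exp (- 4 * s) * exp (- 2 * t))"
proof -
  have "2 * exp (- s) * sinh (t + s) = exp t - exp (- 2 * s) * exp (- t)"
    by (simp add: sinh_def algebra_simps flip: exp_add)
  then have "(2 * exp (- s))\<^sup>2 * (sinh (t + s))\<^sup>2 = (exp t - exp (- 2 * s) * exp (- t))\<^sup>2"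
    unfolding power_mult_distrib[symmetric] by simp
  also have "\<dots> = exp (2 * t) + (- (2 * exp (- 2 * s)) + exp (- 4 * s) * exp (- 2 * t))"
    by (simp add: power2_eq_square algebra_simps flip: exp_add)
  finally show ?thesis .
qed

text \<open>The error is really of order e^(-2s). The weaker e^(-s) suffices, as the oscillation of
  the coefficients is only of order \<mu> = 2 e^(-s).\<close>

lemma warping_factor_error_bound:
  assumes "0 \<le> s"
  shows "k_bounded_on 2 ((2 + 4 * exp (2 * (1 + \<xi>))) * exp (- s)) (model_domain \<xi> :: ('a \<times> real) set)
    (\<lambda>z. - (2 * exp (- 2 * s)) + exp (- 4 * s) * exp (- 2 * snd z))"
proof (rule k_bounded_on_mono)
  show "k_bounded_on 2 (2 * exp (- 2 * s) + \<bar>exp (- 4 * s)\<bar> * (4 * exp (2 * (1 + \<xi>)))) (model_domain \<xi> :: ('a \<times> real) set)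
    (\<lambda>z. - (2 * exp (- 2 * s)) + exp (- 4 * s) * exp (- 2 * snd z))"
    by (intro k_bounded_on_add k_bounded_on_cmult k_bounded_on_const k_bounded_on_exp_snd
        open_model_domain) auto
  have "2 * exp (- 2 * s) \<le> 2 * exp (- s)" using assms by simp
  moreover have "\<bar>exp (- 4 * s)\<bar> * (4 * exp (2 * (1 + \<xi>))) \<le> exp (- s) * (4 * exp (2 * (1 + \<xi>)))"
    using assms by (intro mult_right_mono) auto
  moreover have "(2 + 4 * exp (2 * (1 + \<xi>))) * exp (- s) = 2 * exp (- s) + exp (- s) * (4 * exp (2 * (1 + \<xi>)))"
    by (rule trans[OF distrib_right]) simp
  ultimately show "2 * exp (- 2 * s) + \<bar>exp (- 4 * s)\<bar> * (4 * exp (2 * (1 + \<xi>))) \<le>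
      (2 + 4 * exp (2 * (1 + \<xi>))) * exp (- s)"
    by linarith
qed simp

text \<open>With P the coefficient and P(0) = v . w, the difference splits as (\<mu>^2 sinh^2(t + s)
  - e^(2t)) P + e^(2t) (P - P(0)). For 2/d <= 1 the bound on P is H + 4 (12 (2 H)) = 97 H, and each
  product of two functions costs a factor 2^2; this gives 388, 96 and 3072.\<close>

lemma close_to_model:
  assumes "v \<in> Basis" "w \<in> Basis" "2 / d \<le> 1" "0 \<le> s" "\<mu> = 2 * exp (- s)"
    and "frame_coeff \<rho> a d S W s c \<mu> B v w 0 = v \<bullet> w"
  defines "X \<equiv> exp (2 * (1 + \<xi>))"
  shows "k_bounded_on 2 ((388 * H * (2 + 4 * X) + 96 * X * (DIM('a) * \<beta> * H * E)) * exp (- s) +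
      3072 * X * H * E / d) (model_domain \<xi>)
    (\<lambda>z. \<mu>\<^sup>2 * (sinh (snd z + s))\<^sup>2 * frame_coeff \<rho> a d S W s c \<mu> B v w z - exp (2 * snd z) * (v \<bullet> w))"
proof -
  let ?P = "frame_coeff \<rho> a d S W s c \<mu> B v w"
  have "max 1 (2 / d) = 1" using assms(3) by simp
  then have P: "k_bounded_on 2 (97 * H) (model_domain \<xi>) ?P"
    using frame_coeff_bound[OF assms(1,2)] by simp
  have "k_bounded_on 2 (2\<^sup>2 * (((2 + 4 * X) * exp (- s)) * (97 * H)) +
      2\<^sup>2 * (4 * X * (3 * (DIM('a) * \<beta> * \<mu> * H * E) + 192 * H * E / d))) (model_domain \<xi>)
    (\<lambda>z. (- (2 * exp (- 2 * s)) + exp (- 4 * s) * exp (- 2 * snd z)) * ?P z + exp (2 * snd z) * (?P z - ?P 0))"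
    unfolding X_def
    by (intro k_bounded_on_add k_bounded_on_mult open_model_domain P frame_coeff_increment_bound
        k_bounded_on_exp_snd warping_factor_error_bound assms) simp
  moreover have "2\<^sup>2 * (((2 + 4 * X) * exp (- s)) * (97 * H)) +
      2\<^sup>2 * (4 * X * (3 * (DIM('a) * \<beta> * \<mu> * H * E) + 192 * H * E / d)) =
      (388 * H * (2 + 4 * X) + 96 * X * (DIM('a) * \<beta> * H * E)) * exp (- s) + 3072 * X * H * E / d"
    unfolding assms(5) by (simp add: algebra_simps)
  ultimately have "k_bounded_on 2 ((388 * H * (2 + 4 * X) + 96 * X * (DIM('a) * \<beta> * H * E)) * exp (- s) +
      3072 * X * H * E / d) (model_domain \<xi>)
    (\<lambda>z. (- (2 * exp (- 2 * s)) + exp (- 4 * s) * exp (- 2 * snd z)) * ?P z + exp (2 * snd z) * (?P z - ?P 0))"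
    by simp
  moreover have "(- (2 * exp (- 2 * s)) + exp (- 4 * s) * exp (- 2 * snd z)) * ?P z + exp (2 * snd z) * (?P z - ?P 0) =
      \<mu>\<^sup>2 * (sinh (snd z + s))\<^sup>2 * ?P z - exp (2 * snd z) * (v \<bullet> w)" for z
  proof -
    have wf: "\<mu>\<^sup>2 * (sinh (snd z + s))\<^sup>2 =
        exp (2 * snd z) + (- (2 * exp (- 2 * s)) + exp (- 4 * s) * exp (- 2 * snd z))"
      by (simp only: assms(5) warping_factor)
    show ?thesis unfolding wf assms(6) by (simp add: algebra_simps)
  qed
  ultimately show ?thesis by simp
qed

end

text \<open>
  Shrinking the chart makes the pulled back metric negligible, so that only the model metric remains.
\<close>

lemma shrunk_chart_bound:
  fixes S W :: "'a::euclidean_space tensor2"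
  assumes "warping_cutoff \<rho>" "form_bounds K l U S" "form_bounds K l U W" "open U" "ball c 1 \<subseteq> U"
    and "0 \<le> K" "0 < d" "0 \<le> \<xi>"
  shows "\<exists>\<mu>. 0 < \<mu> \<and> real DIM('a) * \<mu> \<le> 1 \<and>
    (\<forall>v\<in>Basis. \<forall>w\<in>Basis. k_bounded_on 2 (4 * exp (2 * (1 + \<xi>)) + 1) (model_domain \<xi>)
      (\<lambda>z. \<mu>\<^sup>2 * (sinh (snd z + s))\<^sup>2 * frame_coeff \<rho> a d S W s c \<mu> (\<lambda>v. v) v w z - exp (2 * snd z) * (v \<bullet> w)))"
proof -
  define X where "X = exp (2 * (1 + \<xi>))"
  define H where "H = (DIM('a) * 1)\<^sup>2 * K"
  define P where "P = H + 2\<^sup>2 * (max 1 (2 / d) ^ 2 * 12 * (H + H))"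
  \<comment> \<open>A bound for 4 e^(-2s) sinh^2(t + s) times the coefficient, from the expansion in
    \<open>warping_factor\<close>; division by \<open>F\<close> below removes the factor 4
    e^(-2s).\<close>
  define L where "L = 2\<^sup>2 * ((4 * X + (2 * exp (- 2 * s) + \<bar>exp (- 4 * s)\<bar> * (4 * X))) * P)"
  define F where "F = (2 * exp (- s))\<^sup>2"
  \<comment> \<open>The scale 1/D has to satisfy DIM \<mu> <= 1 for the chart and \<mu>^2 L / F <= 1
    for the error. It may depend on \<open>d\<close> and \<open>s\<close>, since no uniformity is
    asked of the chart.\<close>
  define D where "D = DIM('a) + L / F"
  define \<mu> where "\<mu> = 1 / D"
  have "0 \<le> H" using assms by (simp add: H_def)
  then have "0 \<le> P" by (simp add: P_def)
  then have L: "0 \<le> L" by (simp add: L_def X_def)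
  have F: "0 < F" by (simp add: F_def)
  have N: "1 \<le> real DIM('a)" using DIM_positive[where 'a='a] by linarith
  have den: "0 \<le> L / F" using L F by simp
  have D: "1 \<le> D" "DIM('a) \<le> D" "L / F \<le> D" unfolding D_def using N den by linarith+
  have "x * \<mu> \<le> 1" if "x \<le> D" for x
    using that D(1) by (simp add: \<mu>_def divide_le_eq)
  from this[OF D(1)] this[OF D(2)] this[OF D(3)] D(1)
  have \<mu>: "0 < \<mu>" "\<mu> \<le> 1" "DIM('a) * \<mu> \<le> 1" "\<mu> * (L / F) \<le> 1"
    by (simp_all only: \<mu>_def mult.commute) simp_all
  interpret fr: scaled_frame \<rho> K 1 \<mu> \<xi> d a s l U S W c "\<lambda>v. v"
    using assms \<mu> by unfold_locales (auto simp: linear_id[unfolded id_def])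
  have "k_bounded_on 2 (4 * exp (2 * (1 + \<xi>)) + 1) (model_domain \<xi>)
      (\<lambda>z. \<mu>\<^sup>2 * (sinh (snd z + s))\<^sup>2 * frame_coeff \<rho> a d S W s c \<mu> (\<lambda>v. v) v w z - exp (2 * snd z) * (v \<bullet> w))"
    if vw: "v \<in> Basis" "w \<in> Basis" for v w :: 'a
  proof -
    let ?P = "frame_coeff \<rho> a d S W s c \<mu> (\<lambda>v. v) v w"
    have "k_bounded_on 2 P (model_domain \<xi>) ?P"
      using fr.frame_coeff_bound[OF vw] by (simp add: P_def H_def fr.H_def)
    then have "k_bounded_on 2 (\<bar>\<mu>\<^sup>2 / F\<bar> * L + \<bar>v \<bullet> w\<bar> * (4 * X)) (model_domain \<xi>)
      (\<lambda>z. (\<mu>\<^sup>2 / F) * ((exp (2 * snd z) + (- (2 * exp (- 2 * s)) + exp (- 4 * s) * exp (- 2 * snd z))) * ?P z)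
         - (v \<bullet> w) * exp (2 * snd z))"
      unfolding L_def X_def
      by (intro k_bounded_on_diff k_bounded_on_add k_bounded_on_mult k_bounded_on_cmult k_bounded_on_const
          k_bounded_on_exp_snd open_model_domain) auto
    moreover have "\<bar>\<mu>\<^sup>2 / F\<bar> * L + \<bar>v \<bullet> w\<bar> * (4 * X) \<le> 4 * exp (2 * (1 + \<xi>)) + 1"
    proof -
      have "0 \<le> \<mu> * (L / F)" by (rule mult_nonneg_nonneg[OF less_imp_le[OF \<mu>(1)] den])
      have "\<bar>\<mu>\<^sup>2 / F\<bar> * L = \<mu> * (\<mu> * (L / F))" using F by (simp add: power2_eq_square)
      also have "\<dots> \<le> 1 * 1" by (rule mult_mono[OF \<mu>(2,4) zero_le_one]) fact
      finally have "\<bar>\<mu>\<^sup>2 / F\<bar> * L \<le> 1" by simp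
      moreover have "\<bar>v \<bullet> w\<bar> * (4 * X) \<le> 1 * (4 * X)"
        by (intro mult_right_mono) (use vw in \<open>auto simp: inner_Basis X_def\<close>)
      ultimately show ?thesis unfolding X_def by linarith
    qed
    ultimately have "k_bounded_on 2 (4 * exp (2 * (1 + \<xi>)) + 1) (model_domain \<xi>)
      (\<lambda>z. (\<mu>\<^sup>2 / F) * ((exp (2 * snd z) + (- (2 * exp (- 2 * s)) + exp (- 4 * s) * exp (- 2 * snd z))) * ?P z)
         - (v \<bullet> w) * exp (2 * snd z))"
      by (rule k_bounded_on_mono[OF _ subset_refl])
    moreover have "(\<mu>\<^sup>2 / F) * ((exp (2 * t) + (- (2 * exp (- 2 * s)) + exp (- 4 * s) * exp (- 2 * t))) * p) =
        \<mu>\<^sup>2 * (sinh (t + s))\<^sup>2 * p" for t p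
      unfolding fr.warping_factor[symmetric] F_def[symmetric] using F by simp
    ultimately show ?thesis by (simp only: mult.commute[of "v \<bullet> w"])
  qed
  with \<mu>(1,3) show ?thesis by (intro exI[of _ \<mu>] conjI ballI)
qed

section \<open>Radial closeness\<close>


text \<open>Reduces radial closeness at a point to estimates on scalar coefficients. Bilinearity
  moves \<mu>^2 out of the pulled back metric, and s > 1 + \<xi> keeps the time component
  positive.\<close>

lemma chart_radially_close:
  fixes \<psi> :: "'a::euclidean_space \<Rightarrow> 'b::euclidean_space" and B :: "'a \<Rightarrow> 'a"
  assumes ch: "sphere_chart U \<psi>" and g: "riemannian_sphere TYPE('a) g"
    and B: "linear B" "inj B" and "0 < \<mu>"
    and dom: "\<And>x. norm x < 1 \<Longrightarrow> c + \<mu> *\<^sub>R B x \<in> U"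
    and s: "1 + \<xi> < s" and L: "0 \<le> L" "L < \<epsilon>"
    and bd: "\<And>v w. v \<in> Basis \<Longrightarrow> w \<in> Basis \<Longrightarrow> k_bounded_on 2 L (model_domain \<xi>)
      (\<lambda>z. \<mu>\<^sup>2 * (sinh (snd z + s))\<^sup>2 *
        frame_coeff \<rho> a d (pullback \<psi> round_metric) (pullback \<psi> g) s c \<mu> B v w z - exp (2 * snd z) * (v \<bullet> w))"
  shows "\<exists>\<phi> (\<phi>\<^sub>1 :: 'a \<Rightarrow> 'b) t\<^sub>0.
        \<phi> = (\<lambda>(x, t). (\<phi>\<^sub>1 x, t + t\<^sub>0)) \<and>
        sphere_chart (ball 0 1) \<phi>\<^sub>1 \<and>
        \<phi> ` model_domain \<xi> \<subseteq> sphere 0 1 \<times> {0<..} \<and>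
        \<phi> (0, 0) = (\<psi> c, s) \<and>
        C2_norm (model_domain \<xi>) (\<lambda>z v w. pullback \<phi> (warped \<rho> a d g) z v w - model_metric z v w) < ereal \<epsilon>"
proof -
  define \<phi>\<^sub>1 where "\<phi>\<^sub>1 = (\<lambda>x. \<psi> (c + \<mu> *\<^sub>R B x))"
  define \<phi> where "\<phi> = (\<lambda>(x, t). (\<phi>\<^sub>1 x, t + s))"
  define S where "S = pullback \<psi> (round_metric :: 'b tensor2)"
  define W where "W = pullback \<psi> g"
  define F where "F v w z = \<mu>\<^sup>2 * (sinh (snd z + s))\<^sup>2 * frame_coeff \<rho> a d S W s c \<mu> B v w z -
     exp (2 * snd z) * (v \<bullet> w)" for v w z
  have lin: "linear (\<lambda>x. \<mu> *\<^sub>R B x)" by (rule linear_compose_scale_right[OF B(1)])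
  have inj: "inj (\<lambda>x. \<mu> *\<^sub>R B x)" using B(2) \<open>0 < \<mu>\<close> by (auto simp: inj_on_def)
  have chart: "sphere_chart (ball 0 1) \<phi>\<^sub>1"
    unfolding \<phi>\<^sub>1_def by (rule sphere_chart_compose_affine(1)[OF ch lin inj]) (use dom in auto)
  have D1: "frechet_derivative \<phi>\<^sub>1 (at x) v = frechet_derivative \<psi> (at (c + \<mu> *\<^sub>R B x)) (\<mu> *\<^sub>R B v)"
    if "x \<in> ball 0 1" for x v
    unfolding \<phi>\<^sub>1_def by (rule sphere_chart_compose_affine(2)[OF ch lin inj, where V = "ball 0 1"]) (use dom that in auto)
  have dom': "fst z \<in> ball 0 1" "c + \<mu> *\<^sub>R B (fst z) \<in> U" if "z \<in> model_domain \<xi>" for z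
    using that dom by (auto simp: model_domain_def)
  have bilS: "bilinear (S x)" if "x \<in> U" for x
    using sphere_chart_tangent(1)[OF ch that]
    by (auto simp: bilinear_def S_def pullback_def round_metric_def linear_add linear_cmul
        inner_add_left inner_add_right intro!: linearI)
  have bilW: "bilinear (W x)" if "x \<in> U" for x
    unfolding W_def by (rule pullback_riemannian_form(1)[OF g ch that])
  have D: "frechet_derivative \<phi> (at z) v = (frechet_derivative \<phi>\<^sub>1 (at (fst z)) (fst v), snd v)"
    if z: "z \<in> model_domain \<xi>" for z v
  proof -
    have "(\<phi>\<^sub>1 has_derivative frechet_derivative \<phi>\<^sub>1 (at (fst z))) (at (fst z))"
      using chart dom'(1)[OF z] unfolding sphere_chart_def by (blast intro: smooth_on_has_derivative)
    from has_derivative_compose[OF has_derivative_fst[OF has_derivative_ident] this]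
    have "((\<lambda>z. (\<phi>\<^sub>1 (fst z), snd z + s)) has_derivative
        (\<lambda>v. (frechet_derivative \<phi>\<^sub>1 (at (fst z)) (fst v), snd v))) (at z)"
      by (auto intro!: derivative_eq_intros)
    from frechet_derivative_at[OF this, symmetric] show ?thesis
      by (simp add: \<phi>_def case_prod_beta')
  qed
  have diff: "pullback \<phi> (warped \<rho> a d g) z v w - model_metric z v w = F (fst v) (fst w) z"
    if z: "z \<in> model_domain \<xi>" for z v w
  proof -
    define x where "x = c + \<mu> *\<^sub>R B (fst z)"
    have x: "x \<in> U" using dom'(2)[OF z] by (simp add: x_def)
    have "round_metric (\<psi> x) (frechet_derivative \<psi> (at x) (\<mu> *\<^sub>R B u)) (frechet_derivative \<psi> (at x) (\<mu> *\<^sub>R B u'))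
        = \<mu>\<^sup>2 * S x (B u) (B u')" for u u'
    proof -
      have "S x (\<mu> *\<^sub>R B u) (\<mu> *\<^sub>R B u') = \<mu>\<^sup>2 * S x (B u) (B u')"
        using bilS[OF x] by (simp add: bilinear_lmul bilinear_rmul power2_eq_square)
      then show ?thesis by (simp add: S_def pullback_def)
    qed
    moreover have "g (\<psi> x) (frechet_derivative \<psi> (at x) (\<mu> *\<^sub>R B u)) (frechet_derivative \<psi> (at x) (\<mu> *\<^sub>R B u'))
        = \<mu>\<^sup>2 * W x (B u) (B u')" for u u'
    proof -
      have "W x (\<mu> *\<^sub>R B u) (\<mu> *\<^sub>R B u') = \<mu>\<^sup>2 * W x (B u) (B u')"
        using bilW[OF x] by (simp add: bilinear_lmul bilinear_rmul power2_eq_square)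
      then show ?thesis by (simp add: W_def pullback_def)
    qed
    moreover have "\<phi> z = (\<psi> x, snd z + s)" by (simp add: \<phi>_def \<phi>\<^sub>1_def x_def case_prod_beta')
    ultimately show ?thesis
      unfolding pullback_def[of \<phi>] D[OF z] D1[OF dom'(1)[OF z]] x_def[symmetric]
      by (cases z) (simp add: warped_def radial_metric_def deformed_family_def model_metric_def
          F_def frame_coeff_def x_def case_prod_beta' algebra_simps)
  qed
  have bdF: "k_bounded_on 2 L (model_domain \<xi>) (F (fst v) (fst w))"
    if "v \<in> Basis" "w \<in> Basis" for v w :: "'a \<times> real"
  \<comment> \<open>A basis vector with vanishing first component is the time direction. Both
    metrics contain the same dt^2 and no mixed terms, so such entries of the difference are
    zero.\<close>
  proof (cases "fst v = 0 \<or> fst w = 0")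
    case True
    have "k_bounded_on 2 L (model_domain \<xi>) (\<lambda>z. 0)"
      using L by (intro k_bounded_on_const open_model_domain) auto
    then show ?thesis
      by (rule k_bounded_on_cong[OF open_model_domain, rotated])
        (use True bilS bilW dom' in \<open>auto simp: F_def frame_coeff_def linear_0[OF B(1)] bilinear_lzero bilinear_rzero\<close>)
  next
    case False
    then have "fst v \<in> Basis" "fst w \<in> Basis" using that by (auto simp: Basis_prod_def)
    from bd[OF this] show ?thesis by (simp add: F_def[abs_def] S_def W_def)
  qed
  have "C2_norm (model_domain \<xi>) (\<lambda>z v w. pullback \<phi> (warped \<rho> a d g) z v w - model_metric z v w) \<le> ereal L"
  proof (rule C2_norm_le)
    fix v w :: "'a \<times> real" assume "v \<in> Basis" "w \<in> Basis"
    from bdF[OF this] show "k_bounded_on 2 L (model_domain \<xi>)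
        (\<lambda>z. pullback \<phi> (warped \<rho> a d g) z v w - model_metric z v w)"
      by (rule k_bounded_on_cong[OF open_model_domain, rotated]) (simp add: diff)
  qed
  also have "\<dots> < ereal \<epsilon>" using L by simp
  finally have norm: "C2_norm (model_domain \<xi>) (\<lambda>z v w. pullback \<phi> (warped \<rho> a d g) z v w - model_metric z v w) < ereal \<epsilon>" .
  have "\<phi>\<^sub>1 x \<in> sphere 0 1" if "norm x < 1" for x
    unfolding \<phi>\<^sub>1_def by (rule sphere_chart_tangent(2)[OF ch dom[OF that]])
  then have range: "\<phi> ` model_domain \<xi> \<subseteq> sphere 0 1 \<times> {0<..}"
    using s by (auto simp: \<phi>_def model_domain_def)
  have "\<phi> (0, 0) = (\<psi> c, s)" by (simp add: \<phi>_def \<phi>\<^sub>1_def linear_0[OF B(1)])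
  then show ?thesis
    by (rule_tac x = \<phi> in exI, rule_tac x = \<phi>\<^sub>1 in exI, rule_tac x = s in exI)
      (intro conjI \<phi>_def chart range norm)
qed

lemma warped_radially_close:
  fixes \<A> :: "((real ^ 'n) set \<times> (real ^ 'n \<Rightarrow> 'b::euclidean_space)) set"
  assumes \<rho>: "warping_cutoff \<rho>" and \<A>: "admissible_atlas \<A>" and c: "1 < c\<^sub>g" and \<xi>: "0 \<le> \<xi>"
  shows "\<exists>C\<^sub>2. \<forall>(g :: 'b tensor2) a d b \<epsilon>.
     riemannian_sphere TYPE(real ^ 'n) g \<longrightarrow> c_bounded \<A> c\<^sub>g g \<longrightarrow>
     0 < d \<longrightarrow> 1 + \<xi> < b \<longrightarrow> C\<^sub>2 * (exp (- b) + 1 / d) \<le> \<epsilon> \<longrightarrow>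
     radially_close TYPE(real ^ 'n) \<epsilon> \<xi> (warped \<rho> a d g) (polar ` (- ball 0 b))"
proof -
  obtain K0 l0 where S0: "0 < l0" "\<And>U \<psi>. (U, \<psi>) \<in> \<A> \<Longrightarrow> form_bounds K0 l0 U (pullback \<psi> round_metric)"
    using admissible_atlas_round_form_bounds[OF \<A>] by fast
  have "0 < c\<^sub>g" using c by simp
  from c_bounded_form_bounds[OF this]
  obtain l1 where W0: "0 < l1" "\<forall>\<A> (g :: 'b tensor2) U (\<psi> :: real ^ 'n \<Rightarrow> 'b).
    admissible_atlas \<A> \<longrightarrow> riemannian_sphere TYPE(real ^ 'n) g \<longrightarrow> c_bounded \<A> c\<^sub>g g \<longrightarrow>
    (U, \<psi>) \<in> \<A> \<longrightarrow> form_bounds c\<^sub>g l1 U (pullback \<psi> g)"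
    by (elim exE conjE) (rule that)
  define K where "K = max K0 c\<^sub>g"
  define l where "l = min l0 l1"
  \<comment> \<open>The norm bound of an isometric frame for any form bounded below by
    \<open>l\<close>, as supplied by \<open>exists_isometric_frame\<close>.\<close>
  define \<beta> where "\<beta> = 1 / sqrt l"
  define N where "N = real DIM(real ^ 'n)"
  define X where "X = exp (2 * (1 + \<xi>))"
  define H where "H = (N * \<beta>)\<^sup>2 * K"
  define E where "E = 1 + (N + 1) * (2 + \<xi>)"
  define A1 where "A1 = 388 * H * (2 + 4 * X) + 96 * X * (N * \<beta> * H * E)"
  define A2 where "A2 = 3072 * X * H * E"
  \<comment> \<open>The threshold for \<epsilon>: 4 X bounds the derivatives of e^(2t) on the model
    domain, and 1 is the allowance for the shrunken metric.\<close>
  define R where "R = 4 * X + 1"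
  \<comment> \<open>\<open>C\<close> strictly exceeds A1 + A2, which puts the main error strictly
    below \<epsilon>. The last two summands, used when \<epsilon> <= R, force the frame to fit into
    the chart and 2/d <= 1, respectively.\<close>
  define C where "C = 2 * (A1 + A2) + 2 * (N * \<beta> * R) + 2 * R"
  have K: "0 \<le> K" "K0 \<le> K" "c\<^sub>g \<le> K" using c by (auto simp: K_def)
  have l: "0 < l" "l \<le> l0" "l \<le> l1" using S0 W0 by (auto simp: l_def)
  have \<beta>: "0 \<le> \<beta>" using l by (simp add: \<beta>_def)
  have N: "0 \<le> N" by (simp add: N_def)
  have X: "0 < X" by (simp add: X_def)
  have H: "0 \<le> H" using K by (simp add: H_def)
  have E: "0 \<le> E" using N \<xi> by (simp add: E_def)
  have A: "0 \<le> A1" "0 \<le> A2" using N X H E \<beta> by (simp_all add: A1_def A2_def)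
  have R: "0 < R" "0 \<le> N * \<beta> * R" using X N \<beta> by (simp_all add: R_def)
  show ?thesis
  proof (intro exI[of _ C] allI impI)
    fix g :: "'b tensor2" and a d b \<epsilon> :: real
    assume g: "riemannian_sphere TYPE(real ^ 'n) g" and cb: "c_bounded \<A> c\<^sub>g g"
      and d: "0 < d" and b: "1 + \<xi> < b" and \<epsilon>: "C * (exp (- b) + 1 / d) \<le> \<epsilon>"
    define S where "S \<psi> = pullback \<psi> (round_metric :: 'b tensor2)" for \<psi> :: "real ^ 'n \<Rightarrow> 'b"
    define W where "W \<psi> = pullback \<psi> g" for \<psi> :: "real ^ 'n \<Rightarrow> 'b"
    show "radially_close TYPE(real ^ 'n) \<epsilon> \<xi> (warped \<rho> a d g) (polar ` (- ball 0 b))"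
      unfolding radially_close_def
    proof (intro conjI ballI)
      show "\<exists>G. warped \<rho> a d g = radial_metric G" by (auto simp: warped_def)
      fix p assume "p \<in> polar ` (- ball (0::'b) b)"
      then obtain y where y: "p = polar y" "b \<le> norm y" by auto
      define s where "s = norm y"
      have s: "b \<le> s" "1 + \<xi> < s" "0 \<le> s" using y b by (auto simp: s_def)
      have "0 < norm y" using y b \<xi> by linarith
      then have "y /\<^sub>R norm y \<in> sphere 0 1" by simp
      then obtain U \<psi> c where U: "(U, \<psi>) \<in> \<A>" and c: "c \<in> U" "\<psi> c = y /\<^sub>R norm y" "1 \<le> infdist c (- U)"
        using \<A> unfolding admissible_atlas_def by fast
      have p: "p = (\<psi> c, s)" by (simp add: y(1) c(2) polar_def s_def)
      have ch: "sphere_chart U \<psi>" using \<A> U unfolding admissible_atlas_def by auto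
      then have "open U" by (simp add: sphere_chart_def)
      have ball: "ball c 1 \<subseteq> U"
      proof
        fix x assume x: "x \<in> ball c 1"
        show "x \<in> U"
        proof (rule ccontr)
          assume "x \<notin> U"
          then have "infdist c (- U) \<le> dist c x" by (intro infdist_le) simp
          then show False using x c(3) by simp
        qed
      qed
      have fbS: "form_bounds K l U (S \<psi>)"
        unfolding S_def by (rule form_bounds_mono[OF S0(2)[OF U] K(2) l(2)])
      have fbW: "form_bounds K l U (W \<psi>)"
        unfolding W_def by (rule form_bounds_mono[OF W0(2)[rule_format, OF \<A> g cb U] K(3) l(3)])
      have "\<exists>\<mu> B L. 0 < \<mu> \<and> linear B \<and> inj B \<and> (\<forall>x. norm x < 1 \<longrightarrow> c + \<mu> *\<^sub>R B x \<in> U) \<and> 0 \<le> L \<and> L < \<epsilon> \<and>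
        (\<forall>v\<in>Basis. \<forall>w\<in>Basis. k_bounded_on 2 L (model_domain \<xi>)
          (\<lambda>z. \<mu>\<^sup>2 * (sinh (snd z + s))\<^sup>2 * frame_coeff \<rho> a d (S \<psi>) (W \<psi>) s c \<mu> B v w z - exp (2 * snd z) * (v \<bullet> w)))"
      proof (cases "R < \<epsilon>")
        case True
        from shrunk_chart_bound[OF \<rho> fbS fbW \<open>open U\<close> ball K(1) d \<xi>, of s a,
          folded X_def, folded R_def]
        obtain \<mu> :: real where \<mu>: "0 < \<mu>" "DIM(real ^ 'n) * \<mu> \<le> 1"
          "\<forall>v\<in>Basis. \<forall>w\<in>Basis. k_bounded_on 2 R (model_domain \<xi>)
            (\<lambda>z. \<mu>\<^sup>2 * (sinh (snd z + s))\<^sup>2 * frame_coeff \<rho> a d (S \<psi>) (W \<psi>) s c \<mu> (\<lambda>v. v) v w z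
              - exp (2 * snd z) * (v \<bullet> w))"
          by (elim exE conjE) (rule that)
        interpret fr: scaled_frame \<rho> K 1 \<mu> \<xi> d a s l U "S \<psi>" "W \<psi>" c "\<lambda>v. v"
          using \<rho> fbS fbW \<open>open U\<close> ball K(1) d \<xi> \<mu> by unfold_locales (auto simp: linear_id[unfolded id_def])
        show ?thesis
          using \<mu> True R(1) fr.B(1) fr.chart_point_in by (intro exI[of _ \<mu>] exI[of _ "\<lambda>v. v"] exI[of _ R]) auto
      next
        case False
        have pos: "0 < exp (- b)" "0 < 1 / d" using d by auto
        have "C * (exp (- b) + 1 / d) \<le> R" using \<epsilon> False by simp
        \<comment> \<open>Both summands of \<open>C\<close> kept here contain the factor
          \<open>R\<close>. Cancelling it leaves a smallness condition on e^(-b) + 1/d that is free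
          of \<epsilon>.\<close>
        moreover have "(2 * (N * \<beta> * R) + 2 * R) * (exp (- b) + 1 / d) \<le> C * (exp (- b) + 1 / d)"
          using A pos by (intro mult_right_mono) (auto simp: C_def)
        ultimately have "(2 * (N * \<beta>) + 2) * (exp (- b) + 1 / d) * R \<le> 1 * R"
          by (simp add: algebra_simps)
        then have small: "(2 * (N * \<beta>) + 2) * (exp (- b) + 1 / d) \<le> 1"
          using R(1) by (simp only: mult_le_cancel_right_pos)
        have Nb: "0 \<le> N * \<beta>" using N \<beta> by simp
        have "2 * (1 / d) \<le> (2 * (N * \<beta>) + 2) * (exp (- b) + 1 / d)"
          using Nb pos by (intro mult_mono) auto
        then have d2: "2 / d \<le> 1" using small by simp
        define \<mu> where "\<mu> = 2 * exp (- s)"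
        have "(2 * (N * \<beta>)) * exp (- b) \<le> (2 * (N * \<beta>) + 2) * (exp (- b) + 1 / d)"
          using Nb pos by (intro mult_mono) auto
        moreover have "N * \<beta> * \<mu> \<le> (2 * (N * \<beta>)) * exp (- b)"
          using s Nb mult_left_mono[of "exp (- s)" "exp (- b)" "N * \<beta>"] by (simp add: \<mu>_def mult.assoc)
        ultimately have \<mu>1: "N * \<beta> * \<mu> \<le> 1" using small by linarith
        define r where "r = \<rho> (2 * ((s - a) / d))"
        have r: "0 \<le> r" "r \<le> 1" using \<rho> by (auto simp: r_def warping_cutoff_def)
        \<comment> \<open>The deformed metric at time \<open>s\<close> at the centre of the chart.
          As a convex combination it keeps the lower bound \<open>l\<close>, and a frame orthonormal
          for it makes the coefficient matrix the identity at the origin of the model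
          domain.\<close>
        define m where "m v w = S \<psi> c v w + r * (W \<psi> c v w - S \<psi> c v w)" for v w
        have bil: "bilinear (S \<psi> c)" "bilinear (W \<psi> c)" using fbS fbW c(1) by (auto simp: form_bounds_def)
        have mb: "bilinear m"
          using bil unfolding m_def bilinear_def
          by (auto simp: linear_iff algebra_simps)
        have ms: "m v w = m w v" for v w
          using fbS fbW c(1) unfolding m_def form_bounds_def by metis
        have ml: "l * (v \<bullet> v) \<le> m v v" for v
        proof -
          have "(1 - r) * (l * (v \<bullet> v)) \<le> (1 - r) * S \<psi> c v v" "r * (l * (v \<bullet> v)) \<le> r * W \<psi> c v v"
            using fbS fbW c(1) r by (auto simp: form_bounds_def intro!: mult_left_mono)
          then show ?thesis by (simp add: m_def algebra_simps)
        qed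
        from exists_isometric_frame[OF mb ms l(1) ml]
        obtain B :: "real ^ 'n \<Rightarrow> real ^ 'n" where B: "linear B" "\<And>v w. m (B v) (B w) = v \<bullet> w" "\<And>v. norm (B v) \<le> norm v / sqrt l"
          by blast
        interpret fr: scaled_frame \<rho> K \<beta> \<mu> \<xi> d a s l U "S \<psi>" "W \<psi>" c B
        proof (rule scaled_frame.intro)
          show "norm (B v) \<le> \<beta> * norm v" for v using B(3)[of v] by (simp add: \<beta>_def)
          show "linear B" by (rule B(1))
          show "DIM(real ^ 'n) * \<beta> * \<mu> \<le> 1" using \<mu>1 by (simp add: N_def)
        qed (use \<rho> fbS fbW \<open>open U\<close> ball K(1) d \<xi> \<beta> in \<open>auto simp: \<mu>_def\<close>)
        have "inj B"
        proof -
          have "v = 0" if "B v = 0" for v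
            using B(2)[of v v] B(2)[of 0 0] that linear_0[OF B(1)] by simp
          then show ?thesis using linear_injective_0[OF B(1)] by blast
        qed
        have frame0: "frame_coeff \<rho> a d (S \<psi>) (W \<psi>) s c \<mu> B v w 0 = v \<bullet> w" for v w
          using B(2)[of v w] by (simp add: frame_coeff_def linear_0[OF B(1)] m_def r_def)
        define L where "L = A1 * exp (- s) + A2 / d"
        have "L \<le> (A1 + A2) * exp (- b) + (A1 + A2) * (1 / d)"
        proof -
          have "A1 * exp (- s) \<le> (A1 + A2) * exp (- b)"
            using A s by (intro mult_mono) auto
          moreover have "A2 * (1 / d) \<le> (A1 + A2) * (1 / d)"
            using A pos by (intro mult_right_mono) auto
          ultimately show ?thesis by (simp add: L_def)
        qed
        also have "\<dots> = (A1 + A2) * (exp (- b) + 1 / d)" by (simp only: distrib_left)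
        also have "\<dots> < C * (exp (- b) + 1 / d)"
          by (rule mult_strict_right_mono[OF _ add_pos_pos[OF pos]]) (use A R in \<open>simp add: C_def\<close>)
        finally have "L < \<epsilon>" using \<epsilon> by simp
        moreover have "0 \<le> L" using A d by (simp add: L_def)
        moreover have "k_bounded_on 2 L (model_domain \<xi>)
          (\<lambda>z. \<mu>\<^sup>2 * (sinh (snd z + s))\<^sup>2 * frame_coeff \<rho> a d (S \<psi>) (W \<psi>) s c \<mu> B v w z - exp (2 * snd z) * (v \<bullet> w))"
          if "v \<in> Basis" "w \<in> Basis" for v w
          using fr.close_to_model[OF that d2 s(3) \<mu>_def frame0]
          by (simp only: L_def A1_def A2_def X_def H_def E_def N_def
              fr.H_def fr.E_def of_nat_add of_nat_1)
        ultimately show ?thesis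
          using \<open>inj B\<close> B(1) fr.chart_point_in fr.nn(3)
          by (intro exI[of _ \<mu>] exI[of _ B] exI[of _ L]) auto
      qed
      then obtain \<mu> B L where "0 < \<mu>" "linear B" "inj B" "\<And>x. norm x < 1 \<Longrightarrow> c + \<mu> *\<^sub>R B x \<in> U" "0 \<le> L" "L < \<epsilon>"
        "\<And>v w. v \<in> Basis \<Longrightarrow> w \<in> Basis \<Longrightarrow> k_bounded_on 2 L (model_domain \<xi>)
          (\<lambda>z. \<mu>\<^sup>2 * (sinh (snd z + s))\<^sup>2 * frame_coeff \<rho> a d (S \<psi>) (W \<psi>) s c \<mu> B v w z - exp (2 * snd z) * (v \<bullet> w))"
        by blast
      from chart_radially_close[OF ch g this(2,3,1,4) s(2) this(5,6) this(7)[unfolded S_def W_def]]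
      show "\<exists>\<phi> (\<phi>\<^sub>1 :: real ^ 'n \<Rightarrow> 'b) t\<^sub>0.
        \<phi> = (\<lambda>(x, t). (\<phi>\<^sub>1 x, t + t\<^sub>0)) \<and>
        sphere_chart (ball 0 1) \<phi>\<^sub>1 \<and>
        \<phi> ` model_domain \<xi> \<subseteq> sphere 0 1 \<times> {0<..} \<and>
        \<phi> (0, 0) = p \<and>
        C2_norm (model_domain \<xi>) (\<lambda>z v w. pullback \<phi> (warped \<rho> a d g) z v w - model_metric z v w) < ereal \<epsilon>"
        unfolding p .
    qed
  qed
qed

text \<open>The sphere of dimension n = CARD('n) is the unit sphere of the product of
  \<open>real ^ 'n\<close> with the reals, a Euclidean space of dimension n + 1. Cutoff and atlas
  are fixed at the outset, so the constant may depend on them besides the bound on \<open>g\<close>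
  and the excess.\<close>

theorem corollary4p4:
  fixes \<rho> :: "real \<Rightarrow> real"
    and \<A> :: "((real ^ 'n) set \<times> (real ^ 'n \<Rightarrow> (real ^ 'n) \<times> real)) set"
  assumes "warping_cutoff \<rho>"
    and "admissible_atlas \<A>"
  shows "\<forall>c\<^sub>g > 1. \<forall>\<xi> \<ge> 0. \<exists>C\<^sub>2. \<forall>(g :: ((real ^ 'n) \<times> real) tensor2) a d b \<epsilon>.
     riemannian_sphere TYPE(real ^ 'n) g \<longrightarrow> c_bounded \<A> c\<^sub>g g \<longrightarrow>
     0 < a \<longrightarrow> 0 < d \<longrightarrow> 1 + \<xi> < b \<longrightarrow> 0 < \<epsilon> \<longrightarrow>
       hyperbolic_on (ball 0 a) (warped_space \<rho> a d g) \<and>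
       (C\<^sub>2 * (exp (- b) + 1 / d) \<le> \<epsilon> \<longrightarrow>
          radially_close TYPE(real ^ 'n) \<epsilon> \<xi> (warped \<rho> a d g) (polar ` (- ball 0 b)))"
proof (intro allI impI)
  fix c\<^sub>g \<xi> :: real assume "1 < c\<^sub>g" "0 \<le> \<xi>"
  from warped_radially_close[OF assms this]
  obtain C\<^sub>2 where C: "\<forall>(g :: ((real ^ 'n) \<times> real) tensor2) a d b \<epsilon>.
     riemannian_sphere TYPE(real ^ 'n) g \<longrightarrow> c_bounded \<A> c\<^sub>g g \<longrightarrow>
     0 < d \<longrightarrow> 1 + \<xi> < b \<longrightarrow> C\<^sub>2 * (exp (- b) + 1 / d) \<le> \<epsilon> \<longrightarrow>
     radially_close TYPE(real ^ 'n) \<epsilon> \<xi> (warped \<rho> a d g) (polar ` (- ball 0 b))" ..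
  show "\<exists>C\<^sub>2. \<forall>(g :: ((real ^ 'n) \<times> real) tensor2) a d b \<epsilon>.
     riemannian_sphere TYPE(real ^ 'n) g \<longrightarrow> c_bounded \<A> c\<^sub>g g \<longrightarrow>
     0 < a \<longrightarrow> 0 < d \<longrightarrow> 1 + \<xi> < b \<longrightarrow> 0 < \<epsilon> \<longrightarrow>
       hyperbolic_on (ball 0 a) (warped_space \<rho> a d g) \<and>
       (C\<^sub>2 * (exp (- b) + 1 / d) \<le> \<epsilon> \<longrightarrow>
          radially_close TYPE(real ^ 'n) \<epsilon> \<xi> (warped \<rho> a d g) (polar ` (- ball 0 b)))"
    by (intro exI[of _ C\<^sub>2] allI impI conjI hyperbolic_on_warped_space[OF assms(1)] C[rule_format])
qed

end
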